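(* Let $n$ and $h$ be positive integers and put $m=\operatorname{lcm}(n,h)$. Suppose that a $\mathrm{BH}(\mathbb{Z}_n,h)$ matrix exists. Assume moreover that for every prime divisor $p$ of $n$: (i) $p$ divides $h$, and (ii) for every prime divisor $q\neq p$ of $n$, $q^{\operatorname{ord}_{\widetilde{m}_q}(q)}\not\equiv 1 \pmod{p^{\nu_p(h)+1}}$. Then $n\leq \gcd(h,n)^2$.
   Context: For a finite abelian group $(G,+)$ and a positive integer $h$, a $\mathrm{BH}(G,h)$ matrix is a $|G|\times|G|$ matrix $H=(a_{g,k})_{g,k\in G}$ whose entries are complex $h$th roots of unity, which is $G$-invariant (i.e. $a_{g+l,k+l}=a_{g,k}$ for all $g,k,l\in G$), and satisfies $HH^*=|G|I$, where $H^*$ is the conjugate transpose. $\mathbb{Z}_n$ is the cyclic group of order $n$. $\nu_p(x)$ is the $p$-adic valuation of $x$; for coprime integers $a,N$, $\operatorname{ord}_N(a)$ is the least positive $j$ with $a^j\equiv 1\pmod N$. Writing the prime factorization $m=\prod_{i=1}^t p_i^{c_i}$, for a prime divisor $q$ of $n$ define $\widetilde{m}_q=\prod_{p_i\neq q}p_i$ if $m$ is odd or $q=2$, and $\widetilde{m}_q=4\prod_{p_i\neq 2,q}p_i$ otherwise. *)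

theory Defs
  imports "HOL-Number_Theory.Number_Theory" "HOL-Algebra.Elementary_Groups" Complex_Main
begin

text \<open>The group is written multiplicatively, as in HOL-Algebra. A matrix indexed by \<open>G\<close> is a
  function of two arguments, of which only the values on the carrier matter; the last conjunct
  is the entrywise form of \<open>H H\<^sup>* = |G| I\<close>.\<close>

definition BH_matrix ::
    "('g, 'r) monoid_scheme \<Rightarrow> nat \<Rightarrow> ('g \<Rightarrow> 'g \<Rightarrow> complex) \<Rightarrow> bool" where
  "BH_matrix G h a \<longleftrightarrow>
     comm_group G \<and> finite (carrier G) \<and> h > 0 \<and>
     (\<forall>g\<in>carrier G. \<forall>k\<in>carrier G. a g k ^ h = 1) \<and>
     (\<forall>g\<in>carrier G. \<forall>k\<in>carrier G. \<forall>l\<in>carrier G.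
        a (g \<otimes>\<^bsub>G\<^esub> l) (k \<otimes>\<^bsub>G\<^esub> l) = a g k) \<and>
     (\<forall>g\<in>carrier G. \<forall>k\<in>carrier G.
        (\<Sum>l\<in>carrier G. a g l * cnj (a k l)) = (if g = k then of_nat (order G) else 0))"

definition mtilde :: "nat \<Rightarrow> nat \<Rightarrow> nat" where
  "mtilde m q =
     (if odd m \<or> q = 2 then \<Prod>(prime_factors m - {q})
      else 4 * \<Prod>(prime_factors m - {2, q}))"

end

theory Submission
  imports Defs "HOL-Computational_Algebra.Computational_Algebra"
begin

text \<open>
  The first column of the matrix is a sequence \<open>c\<close> of \<open>h\<close>th roots of unity, and
  \<open>X = \<Sum> c\<^sub>u \<zeta>\<^sub>n\<^sup>u\<close> is an integer of the \<open>m\<close>th cyclotomic field with \<open>|X|\<^sup>2 = n\<close>. Put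
  \<open>r = n / gcd(h,n) = m / h\<close>. For each divisor \<open>k\<close> of \<open>r\<close> the sum \<open>X\<close> turns out to be carried by a
  single residue class of \<open>u\<close> modulo \<open>k\<close>; for \<open>k = r\<close> only \<open>gcd(h,n)\<close> terms of absolute value 1
  remain, so \<open>n = |X|\<^sup>2 \<le> gcd(h,n)\<^sup>2\<close>.

  To pass from \<open>k\<close> to \<open>kp\<close>, normalize \<open>X\<close> to an element \<open>Y\<close> of the \<open>M\<close>th cyclotomic ring,
  \<open>M = m/k\<close>, and let \<open>\<sigma>\<close> raise \<open>\<zeta>\<^sub>M\<close> to the power \<open>1 + M/p\<close>, which fixes the \<open>c\<^sub>u\<close>. Condition (ii)
  ensures that for each prime \<open>q\<close> dividing \<open>n\<close>, \<open>\<sigma>\<close> is a power of the Frobenius of \<open>q\<close> on the part of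
  the field unramified at \<open>q\<close>, so \<open>\<sigma>\<close> fixes the prime ideals above \<open>n\<close>. Hence \<open>\<sigma>(Y)/Y\<close> is a unit
  all of whose conjugates have absolute value 1, that is, a root of unity \<open>\<epsilon>\<close>. As \<open>\<sigma>\<close> has order \<open>p\<close>,
  in general \<open>\<epsilon>\<^sup>p = 1\<close>, and \<open>Y\<close> lies in an eigenspace of \<open>\<sigma>\<close>, which is spanned by the terms of one
  residue class modulo \<open>p\<close>. The exception \<open>p = 2\<close>, \<open>\<epsilon> = \<plusminus>i\<close> forces \<open>n\<close> to be a power of 2 with
  \<open>n \<le> 8\<close> and is treated by hand.
\<close>

section \<open>Integer polynomials at complex points\<close>

text \<open>Elements of Z[w] are handled through representing polynomials, so that the automorphism
  taking \<open>w\<close> to \<open>w ^ t\<close> becomes evaluation of the same polynomial at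
  \<open>w ^ t\<close>.\<close>

definition ipoly :: "int poly \<Rightarrow> complex \<Rightarrow> complex" where
  "ipoly P z = poly (map_poly of_int P) z"

lemma ipoly_0 [simp]: "ipoly 0 z = 0"
  by (simp add: ipoly_def)

lemma ipoly_pCons [simp]: "ipoly (pCons a P) z = of_int a + z * ipoly P z"
  by (simp add: ipoly_def map_poly_pCons)

lemma ipoly_1 [simp]: "ipoly 1 z = 1"
  by (simp add: one_pCons)

lemma ipoly_add [simp]: "ipoly (P + Q) z = ipoly P z + ipoly Q z"
proof (induction P arbitrary: Q)
  case (pCons a P)
  then show ?case by (cases Q) (simp add: algebra_simps)
qed simp

lemma ipoly_uminus [simp]: "ipoly (- P) z = - ipoly P z"
  by (induction P) (simp_all add: algebra_simps)

lemma ipoly_diff [simp]: "ipoly (P - Q) z = ipoly P z - ipoly Q z"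
  using ipoly_add[of P "- Q" z] by simp

lemma ipoly_smult [simp]: "ipoly (smult a P) z = of_int a * ipoly P z"
  by (induction P) (simp_all add: algebra_simps)

lemma ipoly_mult [simp]: "ipoly (P * Q) z = ipoly P z * ipoly Q z"
  by (induction P) (simp_all add: algebra_simps)

lemma ipoly_power [simp]: "ipoly (P ^ k) z = ipoly P z ^ k"
  by (induction k) simp_all

lemma ipoly_monom [simp]: "ipoly (monom a k) z = of_int a * z ^ k"
  by (induction k) (simp_all add: monom_Suc monom_0 algebra_simps)

lemma ipoly_pcompose_monom [simp]: "ipoly (pcompose P (monom 1 k)) z = ipoly P (z ^ k)"
  by (induction P) (simp_all add: pcompose_pCons)

lemma ipoly_altdef: "ipoly P z = (\<Sum>i\<le>degree P. of_int (coeff P i) * z ^ i)"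
  by (simp add: ipoly_def poly_altdef degree_map_poly coeff_map_poly)

lemma cnj_ipoly: "cnj (ipoly P z) = ipoly P (cnj z)"
  by (simp add: ipoly_altdef)

section \<open>The ring Z[w] and congruences modulo its principal ideals\<close>

definition int_adjoin :: "complex \<Rightarrow> complex set" where
  "int_adjoin w = range (\<lambda>P. ipoly P w)"

lemma ipoly_in_int_adjoin [intro, simp]: "ipoly P w \<in> int_adjoin w"
  by (simp add: int_adjoin_def)

lemma int_adjoinE:
  assumes "x \<in> int_adjoin w"
  obtains P where "x = ipoly P w"
  using assms by (auto simp: int_adjoin_def)

lemma int_adjoin_self [intro, simp]: "w \<in> int_adjoin w"
  using ipoly_in_int_adjoin[of "[:0, 1:]" w] by simp

lemma int_adjoin_of_int [intro, simp]: "of_int a \<in> int_adjoin w"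
  using ipoly_in_int_adjoin[of "[:a:]" w] by simp

lemma int_adjoin_0 [intro, simp]: "0 \<in> int_adjoin w"
  using int_adjoin_of_int[of 0 w] by simp

lemma int_adjoin_1 [intro, simp]: "1 \<in> int_adjoin w"
  using int_adjoin_of_int[of 1 w] by simp

lemma int_adjoin_of_nat [intro, simp]: "of_nat a \<in> int_adjoin w"
  using int_adjoin_of_int[of "int a" w] by simp

lemma int_adjoin_add [intro]:
  "x \<in> int_adjoin w \<Longrightarrow> y \<in> int_adjoin w \<Longrightarrow> x + y \<in> int_adjoin w"
  by (auto elim!: int_adjoinE simp flip: ipoly_add)

lemma int_adjoin_diff [intro]:
  "x \<in> int_adjoin w \<Longrightarrow> y \<in> int_adjoin w \<Longrightarrow> x - y \<in> int_adjoin w"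
  by (auto elim!: int_adjoinE simp flip: ipoly_diff)

lemma int_adjoin_uminus [intro]: "x \<in> int_adjoin w \<Longrightarrow> - x \<in> int_adjoin w"
  by (auto elim!: int_adjoinE simp flip: ipoly_uminus)

lemma int_adjoin_mult [intro]:
  "x \<in> int_adjoin w \<Longrightarrow> y \<in> int_adjoin w \<Longrightarrow> x * y \<in> int_adjoin w"
  by (auto elim!: int_adjoinE simp flip: ipoly_mult)

lemma int_adjoin_power [intro]: "x \<in> int_adjoin w \<Longrightarrow> x ^ k \<in> int_adjoin w"
  by (induction k) auto

lemma int_adjoin_sum [intro]:
  "(\<And>i. i \<in> A \<Longrightarrow> f i \<in> int_adjoin w) \<Longrightarrow> (\<Sum>i\<in>A. f i) \<in> int_adjoin w"
  by (induction A rule: infinite_finite_induct) auto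

lemma int_adjoin_ipoly [intro]: "v \<in> int_adjoin w \<Longrightarrow> ipoly P v \<in> int_adjoin w"
  by (induction P) auto

text \<open>Congruence of \<open>x\<close> and \<open>y\<close> modulo \<open>d\<close> is written
  \<open>x - y \<in> pideal w d\<close>; membership \<open>d \<in> pideal w e\<close> says that
  \<open>e\<close> divides \<open>d\<close> in Z[w].\<close>

definition pideal :: "complex \<Rightarrow> complex \<Rightarrow> complex set" where
  "pideal w d = (\<lambda>r. d * r) ` int_adjoin w"

lemma pidealI [intro]: "r \<in> int_adjoin w \<Longrightarrow> d * r \<in> pideal w d"
  by (auto simp: pideal_def)

lemma pidealE:
  assumes "x \<in> pideal w d"
  obtains r where "r \<in> int_adjoin w" "x = d * r"
  using assms by (auto simp: pideal_def)

lemma pideal_0 [simp]: "0 \<in> pideal w d"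
  using pidealI[of 0 w d] by simp

lemma pideal_self [simp]: "d \<in> pideal w d"
  using pidealI[of 1 w d] by simp

lemma pideal_1 [simp]: "pideal w 1 = int_adjoin w"
  by (simp add: pideal_def)

lemma pideal_add: "x \<in> pideal w d \<Longrightarrow> y \<in> pideal w d \<Longrightarrow> x + y \<in> pideal w d"
  by (auto elim!: pidealE intro!: pidealI simp flip: distrib_left)

lemma pideal_diff: "x \<in> pideal w d \<Longrightarrow> y \<in> pideal w d \<Longrightarrow> x - y \<in> pideal w d"
  by (auto elim!: pidealE intro!: pidealI simp flip: right_diff_distrib)

lemma pideal_mult_left: "x \<in> pideal w d \<Longrightarrow> r \<in> int_adjoin w \<Longrightarrow> r * x \<in> pideal w d"
  by (auto elim!: pidealE intro!: pidealI simp: mult.left_commute[of r d])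

lemma pideal_mult_right: "x \<in> pideal w d \<Longrightarrow> r \<in> int_adjoin w \<Longrightarrow> x * r \<in> pideal w d"
  using pideal_mult_left[of x w d r] by (simp add: mult.commute)

lemma pideal_sum: "(\<And>i. i \<in> A \<Longrightarrow> f i \<in> pideal w d) \<Longrightarrow> (\<Sum>i\<in>A. f i) \<in> pideal w d"
  by (induction A rule: infinite_finite_induct) (auto intro: pideal_add)

lemma pideal_mult: "x \<in> pideal w d \<Longrightarrow> y \<in> pideal w e \<Longrightarrow> x * y \<in> pideal w (d * e)"
proof (elim pidealE)
  fix r s assume "r \<in> int_adjoin w" "x = d * r" "s \<in> int_adjoin w" "y = e * s"
  then have "d * e * (r * s) \<in> pideal w (d * e)" "x * y = d * e * (r * s)" by auto
  then show ?thesis by simp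
qed

lemma pideal_power: "x \<in> pideal w d \<Longrightarrow> x ^ k \<in> pideal w (d ^ k)"
  by (induction k) (auto intro: pideal_mult)

lemma pideal_trans: "x \<in> pideal w d \<Longrightarrow> d \<in> pideal w e \<Longrightarrow> x \<in> pideal w e"
proof (elim pidealE)
  fix r s assume "r \<in> int_adjoin w" "x = d * r" "s \<in> int_adjoin w" "d = e * s"
  then have "e * (s * r) \<in> pideal w e" "x = e * (s * r)" by auto
  then show ?thesis by simp
qed

lemma pideal_cancel: "c * x \<in> pideal w (c * d) \<Longrightarrow> c \<noteq> 0 \<Longrightarrow> x \<in> pideal w d"
proof (elim pidealE)
  fix r assume "c \<noteq> 0" "r \<in> int_adjoin w" "c * x = c * d * r"
  then have "x = d * r" by simp
  then show ?thesis using \<open>r \<in> int_adjoin w\<close> by auto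
qed

lemma pideal_cong_trans: "x - y \<in> pideal w d \<Longrightarrow> y - z \<in> pideal w d \<Longrightarrow> x - z \<in> pideal w d"
  using pideal_add[of "x - y" w d "y - z"] by simp

lemma pideal_cong_sym: "x - y \<in> pideal w d \<Longrightarrow> y - x \<in> pideal w d"
  using pideal_diff[of 0 w d "x - y"] by simp

lemma pideal_cong_mult:
  assumes "x - y \<in> pideal w d" "x' - y' \<in> pideal w d" "x' \<in> int_adjoin w" "y \<in> int_adjoin w"
  shows "x * x' - y * y' \<in> pideal w d"
proof -
  have "x * x' - y * y' = (x - y) * x' + y * (x' - y')"
    by (simp add: algebra_simps)
  then show ?thesis
    using assms by (simp add: pideal_add pideal_mult_left pideal_mult_right)
qed

lemma pideal_cong_power:
  assumes "x - y \<in> pideal w d" "x \<in> int_adjoin w" "y \<in> int_adjoin w"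
  shows "x ^ k - y ^ k \<in> pideal w d"
proof (induction k)
  case (Suc k)
  then show ?case using assms by (simp add: pideal_cong_mult int_adjoin_power)
qed simp

lemma pideal_cong_ipoly:
  assumes "u - v \<in> pideal w d" "u \<in> int_adjoin w" "v \<in> int_adjoin w"
  shows "ipoly P u - ipoly P v \<in> pideal w d"
proof (induction P)
  case (pCons a P)
  have "u * ipoly P u - v * ipoly P v \<in> pideal w d"
    using assms pCons.IH by (intro pideal_cong_mult int_adjoin_ipoly)
  then show ?case by simp
qed simp

text \<open>Bezout splits \<open>x\<close> into \<open>s * a * x + t * b * x\<close>; in each
  summand the coefficient supplies one of the factors \<open>a\<close>, \<open>b\<close> and the
  divisibility of \<open>x\<close> the other.\<close>

lemma pideal_coprime_combine:
  assumes "x \<in> pideal w (of_nat a)" "x \<in> pideal w (of_nat b)" "coprime a b"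
  shows "x \<in> pideal w (of_nat (a * b))"
proof -
  obtain s t :: int where st: "s * int a + t * int b = 1"
    using assms(3) bezout_int[of "int a" "int b"] by auto
  have "of_nat a * (of_int s * x) \<in> pideal w (of_nat a * of_nat b)"
       "of_nat b * (of_int t * x) \<in> pideal w (of_nat b * of_nat a)"
    by (intro pideal_mult pideal_self pideal_mult_left assms int_adjoin_of_int)+
  then have "of_nat a * (of_int s * x) + of_nat b * (of_int t * x) \<in> pideal w (of_nat (a * b))"
    by (intro pideal_add) (auto simp: mult.commute)
  moreover have "of_nat a * (of_int s * x) + of_nat b * (of_int t * x)
      = of_int (s * int a + t * int b) * x"
    by (simp add: algebra_simps)
  ultimately show ?thesis by (simp add: st)
qed

lemma pideal_prime_powers_combine:
  assumes "n > 0" "\<And>q. prime q \<Longrightarrow> q dvd n \<Longrightarrow> x \<in> pideal w (of_nat (q ^ multiplicity q n))"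
    and "x \<in> int_adjoin w"
  shows "x \<in> pideal w (of_nat n)"
proof -
  have "x \<in> pideal w (of_nat (\<Prod>q\<in>Q. q ^ multiplicity q n))"
    if "finite Q" "Q \<subseteq> prime_factors n" for Q
    using that
  proof (induction Q rule: finite_induct)
    case empty
    then show ?case using assms(3) by simp
  next
    case (insert q Q)
    have "prime q" "q dvd n" using insert by (auto simp: prime_factors_dvd)
    moreover have "coprime (q ^ multiplicity q n) (\<Prod>q\<in>Q. q ^ multiplicity q n)"
    proof (rule prod_coprime_right)
      fix i assume "i \<in> Q"
      then have "prime i" "i \<noteq> q" using insert by (auto simp: prime_factors_dvd)
      then show "coprime (q ^ multiplicity q n) (i ^ multiplicity i n)"
        using \<open>prime q\<close> primes_coprime by (metis coprime_power_left_iff coprime_power_right_iff)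
    qed
    ultimately show ?case
      using insert assms(2)[of q] pideal_coprime_combine by (simp del: of_nat_power of_nat_prod of_nat_mult)
  qed
  from this[of "prime_factors n"] show ?thesis
    using prod_prime_factors[of n] assms(1) by simp
qed

section \<open>Frobenius congruences\<close>

lemma freshman_dream:
  assumes "prime q" "x \<in> int_adjoin w" "y \<in> int_adjoin w"
  shows "(x + y) ^ q - (x ^ q + y ^ q) \<in> pideal w (of_nat q)"
proof -
  have q: "q > 0" using assms(1) by (simp add: prime_gt_0_nat)
  let ?f = "\<lambda>k. of_nat (q choose k) * x ^ k * y ^ (q - k)"
  have "{..q} = insert 0 (insert q {0<..<q})" using q by auto
  then have "(\<Sum>k\<le>q. ?f k) = y ^ q + (x ^ q + (\<Sum>k\<in>{0<..<q}. ?f k))"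
    using q by simp
  then have "(x + y) ^ q - (x ^ q + y ^ q) = (\<Sum>k\<in>{0<..<q}. ?f k)"
    by (simp add: binomial_ring)
  moreover have "?f k \<in> pideal w (of_nat q)" if "k \<in> {0<..<q}" for k
  proof -
    have "q dvd (q choose k)" using that assms(1) by (intro dvd_choose_prime) auto
    then obtain j where j: "q choose k = q * j" by (elim dvdE)
    have "of_nat q * (of_nat j * x ^ k * y ^ (q - k)) \<in> pideal w (of_nat q)"
      using assms by (intro pidealI) auto
    then show ?thesis by (simp add: j mult.assoc)
  qed
  ultimately show ?thesis by (simp only: pideal_sum)
qed

lemma int_power_prime_cong:
  assumes "prime (q :: nat)"
  shows "(of_int a :: complex) ^ q - of_int a \<in> pideal w (of_nat q)"
proof -
  have q: "q > 0" using assms by (simp add: prime_gt_0_nat)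
  have nat: "(of_nat b :: complex) ^ q - of_nat b \<in> pideal w (of_nat q)" for b
  proof (induction b)
    case (Suc b)
    have "(of_nat b + 1) ^ q - (of_nat b ^ q + 1 ^ q) \<in> pideal w (of_nat q)"
      using assms by (intro freshman_dream) auto
    from pideal_add[OF this Suc] show ?case by (simp add: algebra_simps)
  qed (use q in \<open>simp add: power_0_left\<close>)
  show ?thesis
  proof (cases a)
    case (neg b)
    define B where "B = complex_of_nat (Suc b)"
    \<comment> \<open>Applying the freshman's dream to \<open>B + - B = 0\<close> reaches negative
      integers without distinguishing the parity of \<open>q\<close>.\<close>
    have "(B + - B) ^ q - (B ^ q + (- B) ^ q) \<in> pideal w (of_nat q)"
      using assms by (intro freshman_dream) (auto simp: B_def simp del: of_nat_Suc)
    from pideal_add[OF this nat[of "Suc b", folded B_def]]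
    have "- ((- B) ^ q) - B \<in> pideal w (of_nat q)"
      using q by (simp add: power_0_left)
    from pideal_diff[OF pideal_0 this] have "(- B) ^ q - (- B) \<in> pideal w (of_nat q)"
      by (simp add: add.commute)
    then show ?thesis by (simp add: neg B_def)
  qed (use nat in simp)
qed

text \<open>Modulo \<open>q\<close> the integer coefficients equal their own \<open>q\<close>th
  powers by Fermat, so the \<open>q\<close>th power affects only the point of evaluation.\<close>

lemma frobenius_cong:
  assumes "prime q" "v \<in> int_adjoin w"
  shows "ipoly P v ^ q - ipoly P (v ^ q) \<in> pideal w (of_nat q)"
proof (induction P)
  case 0
  then show ?case using assms by (simp add: prime_gt_0_nat power_0_left)
next
  case (pCons a P)
  have 1: "(of_int a + v * ipoly P v) ^ q - (of_int a ^ q + (v * ipoly P v) ^ q) \<in> pideal w (of_nat q)"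
    using assms by (intro freshman_dream) auto
  have 2: "of_int a ^ q - of_int a \<in> pideal w (of_nat q)"
    using assms(1) by (rule int_power_prime_cong)
  have 3: "v ^ q * (ipoly P v ^ q - ipoly P (v ^ q)) \<in> pideal w (of_nat q)"
    using assms pCons by (intro pideal_mult_left) auto
  from pideal_add[OF pideal_add[OF 1 2] 3] show ?case
    by (simp add: algebra_simps power_mult_distrib)
qed

lemma frobenius_power_cong:
  assumes "prime q"
  shows "ipoly P w ^ (q ^ f) - ipoly P (w ^ (q ^ f)) \<in> pideal w (of_nat q)"
proof (induction f)
  case (Suc f)
  have "(ipoly P w ^ (q ^ f)) ^ q - ipoly P (w ^ (q ^ f)) ^ q \<in> pideal w (of_nat q)"
    by (intro pideal_cong_power Suc) auto
  moreover have "ipoly P (w ^ (q ^ f)) ^ q - ipoly P ((w ^ (q ^ f)) ^ q) \<in> pideal w (of_nat q)"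
    by (rule frobenius_cong) (use assms in auto)
  ultimately show ?case
    unfolding power_mult[symmetric] power_Suc2 by (rule pideal_cong_trans)
qed simp

section \<open>Primitive roots of unity\<close>

definition prim_root :: "nat \<Rightarrow> complex \<Rightarrow> bool" where
  "prim_root M w \<longleftrightarrow> M > 0 \<and> (\<forall>j. w ^ j = 1 \<longleftrightarrow> M dvd j)"

lemma prim_rootD:
  assumes "prim_root M w"
  shows "M > 0" "w ^ M = 1" "w ^ j = 1 \<longleftrightarrow> M dvd j" "w \<noteq> 0" "norm w = 1"
proof -
  show M: "M > 0" and 1: "w ^ M = 1" and "w ^ j = 1 \<longleftrightarrow> M dvd j"
    using assms by (auto simp: prim_root_def)
  then show "w \<noteq> 0" by (auto simp: power_0_left)
  have "norm w ^ M = 1" using 1 by (metis norm_one norm_power)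
  then show "norm w = 1" using power_eq_imp_eq_base[of "norm w" M 1] M by simp
qed

lemma prim_root_cis: "M > 0 \<Longrightarrow> prim_root M (cis (2 * pi / M))"
  unfolding prim_root_def
proof (intro conjI allI)
  fix j assume M: "M > 0"
  have "cis (2 * pi / M) ^ j = cis (j * (2 * pi / M))" by (simp add: DeMoivre)
  also have "\<dots> = 1 \<longleftrightarrow> (\<exists>k::int. j * (2 * pi / M) = 2 * pi * k)"
  proof -
    have "cis x = 1 \<longleftrightarrow> cos x = 1" for x
      by (auto simp: complex_eq_iff cos_one_sin_zero)
    then show ?thesis by (simp add: cos_one_2pi_int mult_ac)
  qed
  also have "\<dots> \<longleftrightarrow> (\<exists>k::int. int j = int M * k)"
  proof -
    have "j * (2 * pi / M) = 2 * pi * k \<longleftrightarrow> int j = int M * k" for k :: int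
    proof -
      have "j * (2 * pi / M) = 2 * pi * k \<longleftrightarrow> real j = real M * real_of_int k"
        using M by (auto simp: field_simps)
      also have "\<dots> \<longleftrightarrow> real_of_int (int j) = real_of_int (int M * k)" by simp
      finally show ?thesis by (simp only: of_int_eq_iff)
    qed
    then show ?thesis by simp
  qed
  also have "\<dots> \<longleftrightarrow> M dvd j" using int_dvd_int_iff[of M j] by (auto simp: dvd_def)
  finally show "cis (2 * pi / M) ^ j = 1 \<longleftrightarrow> M dvd j" .
qed

lemma prim_root_power_coprime:
  assumes "prim_root M w" "coprime t M"
  shows "prim_root M (w ^ t)"
  using assms by (auto simp: prim_root_def power_mult[symmetric] coprime_commute coprime_dvd_mult_right_iff)

lemma prim_root_power_dvd:
  assumes "prim_root (M * k) w"
  shows "prim_root M (w ^ k)"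
  using assms by (auto simp: prim_root_def power_mult[symmetric] mult.commute)

lemma prim_root_power_mod:
  assumes "prim_root M w"
  shows "w ^ (j mod M) = w ^ j"
proof -
  have "w ^ j = w ^ (M * (j div M) + j mod M)" by simp
  also have "\<dots> = w ^ (j mod M)"
    using prim_rootD(2)[OF assms] by (simp only: power_add power_mult) simp
  finally show ?thesis by simp
qed

lemma prim_root_power_eq_iff:
  assumes "prim_root M w"
  shows "w ^ i = w ^ j \<longleftrightarrow> [i = j] (mod M)"
proof
  assume "[i = j] (mod M)"
  then show "w ^ i = w ^ j"
    using prim_root_power_mod[OF assms] by (metis cong_def)
next
  have *: "[i = j] (mod M)" if "w ^ i = w ^ j" "i \<le> j" for i j
  proof -
    have "w ^ j = w ^ i * w ^ (j - i)" using that(2) by (simp flip: power_add)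
    then have "w ^ (j - i) = 1" using that(1) prim_rootD(4)[OF assms] by simp
    then have "M dvd j - i" using prim_rootD(3)[OF assms] by simp
    then show ?thesis using that(2) by (metis cong_altdef_nat cong_sym)
  qed
  assume "w ^ i = w ^ j"
  then show "[i = j] (mod M)" using *[of i j] *[of j i] by (metis cong_sym le_cases)
qed

lemma prim_root_cnj:
  assumes "prim_root M w"
  shows "cnj w = w ^ (M - 1)"
proof -
  have "w * cnj w = 1" using prim_rootD(5)[OF assms] by (simp add: complex_norm_square[symmetric])
  moreover have "w * w ^ (M - 1) = 1"
    using prim_rootD(1,2)[OF assms] by (simp flip: power_Suc)
  ultimately show ?thesis using prim_rootD(4)[OF assms] mult_left_cancel[of w "cnj w"] by simp
qed

lemma prim_root_sum_powers:
  assumes "prim_root M w"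
  shows "(\<Sum>a<M. w ^ (a * k)) = (if M dvd k then of_nat M else 0)"
proof (cases "M dvd k")
  case True
  then have "w ^ (a * k) = 1" for a using prim_rootD(3)[OF assms] by simp
  then show ?thesis using True by simp
next
  case False
  then have 1: "w ^ k \<noteq> 1" using prim_rootD(3)[OF assms] by simp
  have "(\<Sum>a<M. w ^ (a * k)) = (\<Sum>a<M. (w ^ k) ^ a)"
    by (simp add: power_mult[symmetric] mult.commute)
  also have "\<dots> = ((w ^ k) ^ M - 1) / (w ^ k - 1)" using 1 by (rule geometric_sum)
  also have "(w ^ k) ^ M = (w ^ M) ^ k" by (simp add: power_mult[symmetric] mult.commute)
  finally show ?thesis using False prim_rootD(2)[OF assms] by simp
qed

lemma root_of_unity_eq_power:
  assumes "prim_root M w" "y ^ M = 1"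
  obtains s where "y = w ^ s" "s < M"
proof -
  have M: "M > 0" using prim_rootD(1)[OF assms(1)] .
  have "inj_on (\<lambda>s. w ^ s) {..<M}"
    using prim_root_power_eq_iff[OF assms(1)] by (auto simp: inj_on_def cong_def)
  then have "card ((\<lambda>s. w ^ s) ` {..<M}) = M" by (simp add: card_image)
  moreover have sub: "(\<lambda>s. w ^ s) ` {..<M} \<subseteq> {z. z ^ M = 1}"
  proof -
    have "(w ^ s) ^ M = (w ^ M) ^ s" for s by (simp add: power_mult[symmetric] mult.commute)
    then show ?thesis using prim_rootD(2)[OF assms(1)] by auto
  qed
  moreover have "card {z :: complex. z ^ M = 1} = M" using card_roots_unity_eq[of M] M by simp
  ultimately have "(\<lambda>s. w ^ s) ` {..<M} = {z. z ^ M = 1}"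
    using finite_roots_unity[of M, where ?'a = complex] M by (intro card_subset_eq) auto
  then have "y \<in> (\<lambda>s. w ^ s) ` {..<M}" using assms(2) by simp
  then show ?thesis using that by auto
qed

section \<open>Minimal polynomials and conjugates of roots of unity\<close>

text \<open>\<open>f\<close> is the primitive part of an integer polynomial of least degree
  vanishing at \<open>w\<close>. By Gauss's lemma it divides every other one over the integers, in
  particular x^M - 1, with cofactor \<open>g\<close>.\<close>

lemma prim_root_min_poly:
  assumes "prim_root M w"
  obtains f g where "f * g = monom 1 M - 1" "ipoly f w = 0" "\<And>P. ipoly P w = 0 \<Longrightarrow> f dvd P"
proof -
  have M: "M > 0" "w ^ M = 1" using prim_rootD[OF assms] by auto
  define good where "good P \<longleftrightarrow> P \<noteq> 0 \<and> ipoly P w = 0" for P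
  have "good (monom 1 M - 1)"
  proof -
    have "coeff (monom 1 M - 1 :: int poly) M = 1" using M by simp
    then have "(monom 1 M - 1 :: int poly) \<noteq> 0" by force
    then show ?thesis using M by (simp add: good_def)
  qed
  then obtain P0 where P0: "good P0" "\<And>P. good P \<Longrightarrow> degree P0 \<le> degree P"
    using ex_has_least_nat[of good _ degree] by blast
  define f where "f = primitive_part P0"
  have f: "f \<noteq> 0" "content f = 1" "degree f = degree P0"
    using P0(1) by (auto simp: f_def good_def)
  have f0: "ipoly f w = 0"
  proof -
    have "P0 = smult (content P0) f" by (simp add: f_def)
    then have "of_int (content P0) * ipoly f w = 0" using P0(1) by (metis good_def ipoly_smult)
    then show ?thesis using P0(1) by (simp add: good_def)
  qed
  have dvd: "f dvd P" if "ipoly P w = 0" for P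
  proof -
    define r where "r = pseudo_mod P f"
    obtain a q where aq: "a \<noteq> 0" "smult a P = f * q + r"
      using pseudo_mod(1)[OF f(1), of P] unfolding r_def by blast
    have "r = 0 \<or> degree r < degree f" unfolding r_def by (rule pseudo_mod(2)[OF f(1)])
    moreover have "ipoly (smult a P) w = ipoly (f * q + r) w" by (simp only: aq(2))
    then have "ipoly r w = 0" using that f0 by simp
    ultimately have "r = 0" using P0(2)[of r] f(3) unfolding good_def by linarith
    then have *: "smult a P = f * q" using aq by simp
    \<comment> \<open>As \<open>f\<close> is primitive, comparing contents shows that the factor
      \<open>a\<close> introduced by pseudo-division divides \<open>q\<close> and can be
      cancelled.\<close>
    then have "content (smult a P) = content q" using f(2) by (simp add: content_mult)
    then have "\<bar>a\<bar> dvd content q" by (metis content_smult dvd_triv_left normalize_int_def)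
    then have "[:a:] dvd q" by (simp add: const_poly_dvd_iff_dvd_content)
    then obtain q' where "q = [:a:] * q'" by (elim dvdE)
    then have "smult a P = smult a (f * q')" using * by simp
    then have "P = f * q'" using aq(1) by (simp only: smult_cancel)
    then show ?thesis by simp
  qed
  have "f dvd monom 1 M - 1" using M by (intro dvd) simp
  then show ?thesis using that f0 dvd by (metis dvdE)
qed

text \<open>In a relation 1 = l Q(w), the polynomial Q can be reduced modulo \<open>f\<close>, whose
  leading coefficient is 1 or -1. The result is a polynomial l B - c with c = 1 or c = -1, of
  smaller degree than \<open>f\<close> and vanishing at \<open>w\<close>; hence it is 0, and l would
  divide c.\<close>

lemma prime_not_unit_int_adjoin:
  assumes "prim_root M w" "prime l"
  shows "1 \<notin> pideal w (of_nat l)"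
proof
  assume "1 \<in> pideal w (of_nat l)"
  then obtain Q where Q: "1 = of_nat l * ipoly Q w" by (elim pidealE int_adjoinE) simp
  obtain f g where fg: "f * g = monom 1 M - 1" "ipoly f w = 0" "\<And>P. ipoly P w = 0 \<Longrightarrow> f dvd P"
    using prim_root_min_poly[OF assms(1)] by blast
  have M: "M > 0" using prim_rootD(1)[OF assms(1)] .
  have "coeff (f * g) M = 1" using fg(1) M by simp
  then have f0: "f \<noteq> 0" by auto
  have "degree (f * g) = M" unfolding fg(1) using M
    by (subst diff_conv_add_uminus, subst degree_add_eq_left) (auto simp: degree_monom_eq)
  with \<open>coeff (f * g) M = 1\<close> have "lead_coeff (f * g) = 1" by simp
  then have "lead_coeff f * lead_coeff g = 1" by (simp only: lead_coeff_mult)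
  then have lc: "lead_coeff f = 1 \<or> lead_coeff f = -1" by (simp add: zmult_eq_1_iff) auto
  obtain A B where AB: "pseudo_divmod Q f = (A, B)" by force
  define c where "c = lead_coeff f ^ (Suc (degree Q) - degree f)"
  have c: "c = 1 \<or> c = -1" using lc
    by (auto simp: c_def neg_one_even_power neg_one_odd_power)
      (metis neg_one_even_power neg_one_odd_power)
  have div: "smult c Q = f * A + B" "B = 0 \<or> degree B < degree f"
    using pseudo_divmod[OF f0 AB] by (auto simp: c_def)
  have degf: "degree f > 0"
  proof (rule ccontr)
    assume "\<not> degree f > 0"
    then obtain a where a: "f = [:a:]" by (metis degree_eq_zeroE gr0I)
    then show False using fg(2) f0 by simp
  qed
  have "ipoly (smult c Q) w = ipoly (f * A + B) w" by (simp only: div(1))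
  then have "of_int c * ipoly Q w = ipoly B w" using fg(2) by simp
  then have "ipoly (smult (int l) B - [:c:]) w = of_int c * (of_nat l * ipoly Q w - 1)"
    by (simp add: algebra_simps)
  also have "\<dots> = 0" by (simp flip: Q)
  finally have "f dvd smult (int l) B - [:c:]" using fg(3) by blast
  moreover have "degree (smult (int l) B - [:c:]) < degree f"
    using div(2) degf by (intro degree_diff_less) auto
  ultimately have "smult (int l) B - [:c:] = 0"
    using dvd_imp_degree_le leD by blast
  then have "coeff (smult (int l) B - [:c:]) 0 = 0" by simp
  then have "int l dvd c" by (simp add: dvd_def) (metis eq_iff_diff_eq_0)
  then have "int l dvd 1" using c by auto
  then show False using assms(2) by (simp add: prime_nat_not_dvd)
qed

text \<open>Dedekind's argument: if f(v) were nonzero for v = w^l, then g(v) = 0, and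
  differentiating x^M - 1 = f g at v shows that f(v) divides M. But f(v) is congruent to f(w)^l = 0
  modulo l, so l would divide both M and l in Z[w], hence also 1.\<close>

lemma ipoly_conjugate_prime:
  assumes w: "prim_root M w" and l: "prime l" "\<not> l dvd M" and P: "ipoly P w = 0"
  shows "ipoly P (w ^ l) = 0"
proof -
  obtain f g where fg: "f * g = monom 1 M - 1" "ipoly f w = 0" "\<And>P. ipoly P w = 0 \<Longrightarrow> f dvd P"
    using prim_root_min_poly[OF w] by blast
  have M: "M > 0" "w ^ M = 1" using prim_rootD[OF w] by auto
  define v where "v = w ^ l"
  have vM: "v ^ M = 1" using M(2) by (simp add: v_def power_mult[symmetric] mult.commute) (simp add: power_mult)
  have "ipoly f v = 0"
  proof (rule ccontr)
    assume "ipoly f v \<noteq> 0"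
    moreover have "ipoly (f * g) v = 0" by (simp add: fg(1) vM)
    ultimately have gv: "ipoly g v = 0" by simp
    have "ipoly (pderiv (f * g)) v = ipoly (monom (int M) (M - 1)) v"
      by (simp add: fg(1) pderiv_diff pderiv_monom)
    then have "ipoly f v * ipoly (pderiv g) v = of_nat M * v ^ (M - 1)"
      by (simp add: pderiv_mult gv)
    then have "ipoly f v * ipoly (pderiv g) v * v = of_nat M * (v ^ (M - 1) * v)" by simp
    also have "v ^ (M - 1) * v = 1" using vM M(1) by (simp flip: power_Suc2)
    finally have Meq: "ipoly f v * (ipoly (pderiv g) v * v) = of_nat M" by (simp add: mult.assoc)
    have "ipoly f w ^ l - ipoly f (w ^ l) \<in> pideal w (of_nat l)"
      using l by (intro frobenius_cong) auto
    then have "ipoly f v \<in> pideal w (of_nat l)"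
      using pideal_diff[OF pideal_0] fg(2) prime_gt_0_nat[OF l(1)] by (force simp: v_def power_0_left)
    then have "ipoly f v * (ipoly (pderiv g) v * v) \<in> pideal w (of_nat l)"
      by (intro pideal_mult_right) (auto simp: v_def)
    then have Min: "of_nat M \<in> pideal w (of_nat l)" by (simp add: Meq)
    have "coprime l M" using l by (simp add: prime_imp_coprime)
    then obtain s t :: int where st: "s * int l + t * int M = 1"
      using bezout_int[of "int l" "int M"] by auto
    have "of_int s * of_nat l + of_int t * of_nat M \<in> pideal w (of_nat l)"
      using Min by (intro pideal_add pideal_mult_left) auto
    moreover have "of_int s * of_nat l + of_int t * of_nat M = (of_int (s * int l + t * int M) :: complex)"
      by simp
    ultimately show False using prime_not_unit_int_adjoin[OF w l(1)] by (simp only: st of_int_1)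
  qed
  moreover obtain Q where "P = f * Q" using fg(3)[OF P] by (elim dvdE)
  ultimately show ?thesis by (simp add: v_def)
qed

text \<open>This is the irreducibility of the cyclotomic polynomials.\<close>

lemma ipoly_conjugate:
  assumes "prim_root M w" "coprime t M" "ipoly P w = 0"
  shows "ipoly P (w ^ t) = 0"
  using assms
proof (induction t arbitrary: w rule: prime_divisors_induct)
  case zero
  \<comment> \<open>Coprimality of 0 and \<open>M\<close> forces \<open>M = 1\<close>, so
    \<open>w = 1\<close>.\<close>
  then have "w ^ 1 = 1" using prim_rootD(3)[of M w 1] by simp
  then show ?case using zero by simp
next
  case (unit t)
  then show ?case by simp
next
  case (factor l t)
  have "\<not> l dvd M" using factor by (metis coprime_common_divisor dvd_triv_left not_prime_unit)
  then have "ipoly P (w ^ l) = 0" using factor by (intro ipoly_conjugate_prime[of M]) auto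
  moreover have "prim_root M (w ^ l)" using factor by (intro prim_root_power_coprime) auto
  ultimately show ?case using factor by (simp add: power_mult)
qed

lemma coprimeI_prime_nat:
  fixes a b :: nat
  assumes "\<And>p. prime p \<Longrightarrow> p dvd a \<Longrightarrow> p dvd b \<Longrightarrow> False"
  shows "coprime a b"
proof (rule ccontr)
  assume "\<not> coprime a b"
  then have "gcd a b \<noteq> 1" using coprime_iff_gcd_eq_1 by blast
  then obtain p where "prime p" "p dvd gcd a b" using prime_factor_nat by blast
  then show False using assms[of p] by simp
qed

section \<open>Kronecker's theorem\<close>

text \<open>For \<open>i < M\<close>, the coefficient of x^i in the reduction of \<open>Q\<close>
  modulo x^M - 1.\<close>

definition residue_coeff :: "nat \<Rightarrow> int poly \<Rightarrow> nat \<Rightarrow> int" where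
  "residue_coeff M Q i = (\<Sum>k | k \<le> degree Q \<and> k mod M = i. coeff Q k)"

lemma ipoly_residue_coeff:
  assumes "prim_root M w"
  shows "ipoly Q w = (\<Sum>i<M. of_int (residue_coeff M Q i) * w ^ i)"
proof -
  have "ipoly Q w = (\<Sum>k\<in>{..degree Q}. of_int (coeff Q k) * w ^ (k mod M))"
    by (simp add: ipoly_altdef prim_root_power_mod[OF assms])
  also have "\<dots> = (\<Sum>i\<in>{..<M}. \<Sum>k\<in>{k \<in> {..degree Q}. k mod M = i}. of_int (coeff Q k) * w ^ (k mod M))"
    using prim_rootD(1)[OF assms] by (intro sum.group[symmetric]) auto
  finally show ?thesis by (simp add: residue_coeff_def sum_distrib_right)
qed

text \<open>Inverse discrete Fourier transform over all \<open>M\<close>th roots of unity, primitive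
  or not; the exponent \<open>M - i\<close> stands for \<open>- i\<close>.\<close>

lemma residue_coeff_fourier:
  assumes "prim_root M w" "i < M"
  shows "of_nat M * of_int (residue_coeff M Q i) = (\<Sum>a<M. ipoly Q (w ^ a) * w ^ (a * (M - i)))"
proof -
  have "(\<Sum>a<M. ipoly Q (w ^ a) * w ^ (a * (M - i)))
      = (\<Sum>a<M. \<Sum>k\<le>degree Q. of_int (coeff Q k) * w ^ (a * (k + (M - i))))"
    by (simp add: ipoly_altdef sum_distrib_right power_mult[symmetric] distrib_left power_add mult.assoc)
  also have "\<dots> = (\<Sum>k\<le>degree Q. of_int (coeff Q k) * (\<Sum>a<M. w ^ (a * (k + (M - i)))))"
    by (subst sum.swap) (simp add: sum_distrib_left)
  also have "\<dots> = (\<Sum>k\<le>degree Q. if k mod M = i then of_int (coeff Q k) * of_nat M else 0)"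
  proof (intro sum.cong refl)
    fix k
    have "M dvd k + (M - i) \<longleftrightarrow> k mod M = i"
    proof -
      have "M dvd k + (M - i) \<longleftrightarrow> [k + (M - i) + i = 0 + i] (mod M)"
        by (simp only: cong_add_rcancel_nat cong_0_iff)
      also have "k + (M - i) + i = k + M" using assms(2) by simp
      also have "[k + M = 0 + i] (mod M) \<longleftrightarrow> k mod M = i" using assms(2) by (simp add: cong_def)
      finally show ?thesis .
    qed
    then show "of_int (coeff Q k) * (\<Sum>a<M. w ^ (a * (k + (M - i))))
        = (if k mod M = i then of_int (coeff Q k) * of_nat M else 0)"
      by (simp add: prim_root_sum_powers[OF assms(1)])
  qed
  also have "\<dots> = of_nat M * of_int (residue_coeff M Q i)"
    by (simp add: residue_coeff_def sum.If_cases sum_distrib_left mult.commute Int_def)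
  finally show ?thesis ..
qed

text \<open>Kronecker's theorem for cyclotomic integers. The powers \<open>\<epsilon>\<^sup>j\<close>, multiplied by the
  cofactor \<open>g\<close> of the minimal polynomial in \<open>x\<^sup>M - 1\<close>, have bounded Fourier
  transforms, since \<open>g\<close> vanishes at all roots of unity that are not conjugate to \<open>w\<close>; hence
  their integer coefficients modulo \<open>x\<^sup>M - 1\<close> take finitely many values.\<close>

lemma int_adjoin_norm_one_root_of_unity:
  assumes w: "prim_root M w" and eps: "eps \<in> int_adjoin w" "norm eps = 1"
  obtains L where "L > 0" "eps ^ L = 1"
proof -
  obtain f g where fg: "f * g = monom 1 M - 1" "ipoly f w = 0" "\<And>P. ipoly P w = 0 \<Longrightarrow> f dvd P"
    using prim_root_min_poly[OF w] by blast
  note M = prim_rootD[OF w]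
  obtain P where P: "eps = ipoly P w" using eps(1) by (elim int_adjoinE)
  have cnj_w: "cnj (w ^ a) = (w ^ a) ^ (M - 1)" for a
    by (simp add: prim_root_cnj[OF w] power_mult[symmetric] mult.commute)
  have P1: "norm (ipoly P (w ^ a)) = 1" if "ipoly f (w ^ a) = 0" for a
  proof -
    \<comment> \<open>Since \<open>cnj w = w ^ (M - 1)\<close>, the equation
      \<open>norm eps = 1\<close> says that an integer polynomial vanishes at \<open>w\<close>; it
      then vanishes at every zero of \<open>f\<close>.\<close>
    define Q where "Q = P * pcompose P (monom 1 (M - 1)) - 1"
    have "ipoly Q w = eps * cnj eps - 1"
      using cnj_w[of 1] by (simp add: Q_def P cnj_ipoly)
    also have "\<dots> = 0" using eps(2) by (simp flip: complex_norm_square)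
    finally obtain K where "Q = f * K" using fg(3) by (metis dvdE)
    then have "ipoly Q (w ^ a) = 0" using that by simp
    then have "ipoly P (w ^ a) * cnj (ipoly P (w ^ a)) = 1"
      by (simp add: Q_def cnj_ipoly cnj_w[unfolded complex_cnj_power])
    then have "complex_of_real ((norm (ipoly P (w ^ a)))\<^sup>2) = 1" by (simp only: complex_norm_square)
    then have "(norm (ipoly P (w ^ a)))\<^sup>2 = 1" by (simp only: of_real_eq_1_iff)
    then show ?thesis by (simp add: power2_eq_1_iff) (smt (verit) norm_ge_zero)
  qed
  \<comment> \<open>Otherwise \<open>w\<close> would be a double zero of x^M - 1.\<close>
  have g0: "ipoly g w \<noteq> 0"
  proof
    assume g: "ipoly g w = 0"
    have "ipoly (pderiv (f * g)) w = ipoly (monom (int M) (M - 1)) w"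
      by (simp add: fg(1) pderiv_diff pderiv_monom)
    then show False using M by (simp add: pderiv_mult g fg(2))
  qed
  define Bd where "Bd = (\<Sum>a<M. norm (ipoly g (w ^ a)))"
  define cf where "cf j = restrict (residue_coeff M (P ^ j * g)) {..<M}" for j
  have bound: "\<bar>real_of_int (residue_coeff M (P ^ j * g) i)\<bar> \<le> Bd" if "i < M" for i j
  proof -
    have "norm (of_nat M * of_int (residue_coeff M (P ^ j * g) i) :: complex)
        \<le> (\<Sum>a<M. norm (ipoly (P ^ j * g) (w ^ a) * w ^ (a * (M - i))))"
      unfolding residue_coeff_fourier[OF w that] by (rule norm_sum)
    also have "\<dots> \<le> Bd" unfolding Bd_def
    proof (intro sum_mono)
      fix a
      have "ipoly (f * g) (w ^ a) = 0"
      proof -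
        have "(w ^ a) ^ M = (w ^ M) ^ a" by (simp add: power_mult[symmetric] mult.commute)
        then show ?thesis by (simp add: fg(1) M(2))
      qed
      then consider "ipoly g (w ^ a) = 0" | "ipoly f (w ^ a) = 0" by auto
      then show "norm (ipoly (P ^ j * g) (w ^ a) * w ^ (a * (M - i))) \<le> norm (ipoly g (w ^ a))"
        by cases (auto simp: norm_mult norm_power P1 M(5))
    qed
    finally have "real M * \<bar>real_of_int (residue_coeff M (P ^ j * g) i)\<bar> \<le> Bd"
      by (simp add: norm_mult)
    moreover have "1 * \<bar>real_of_int (residue_coeff M (P ^ j * g) i)\<bar>
        \<le> real M * \<bar>real_of_int (residue_coeff M (P ^ j * g) i)\<bar>"
      using M(1) by (intro mult_right_mono) auto
    ultimately show ?thesis by simp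
  qed
  have "range cf \<subseteq> PiE {..<M} (\<lambda>_. {-\<lfloor>Bd\<rfloor>..\<lfloor>Bd\<rfloor>})"
  proof -
    have "residue_coeff M (P ^ j * g) i \<in> {-\<lfloor>Bd\<rfloor>..\<lfloor>Bd\<rfloor>}" if "i < M" for i j
    proof -
      have "\<bar>residue_coeff M (P ^ j * g) i\<bar> \<le> \<lfloor>Bd\<rfloor>" using bound[OF that, of j] by (simp add: le_floor_iff)
      then show ?thesis by auto
    qed
    then show ?thesis unfolding cf_def by (intro image_subsetI) (auto simp: PiE_iff)
  qed
  moreover have "finite (PiE {..<M} (\<lambda>_. {-\<lfloor>Bd\<rfloor>..\<lfloor>Bd\<rfloor>}))" by (intro finite_PiE) auto
  ultimately have "finite (range cf)" by (rule finite_subset)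
  \<comment> \<open>By the pigeonhole principle two powers of \<open>eps\<close> agree after
    multiplication by g(w), which is nonzero and cancels.\<close>
  then have "\<not> inj cf" using finite_imageD infinite_UNIV_nat by blast
  then obtain j1 j2 where j: "cf j1 = cf j2" "j1 < j2"
    unfolding inj_def by (metis linorder_neqE_nat)
  have "residue_coeff M (P ^ j1 * g) i = residue_coeff M (P ^ j2 * g) i" if "i < M" for i
    using fun_cong[OF j(1), of i] that by (simp add: cf_def)
  then have "ipoly (P ^ j1 * g) w = ipoly (P ^ j2 * g) w"
    by (simp only: ipoly_residue_coeff[OF w]) simp
  then have "eps ^ j1 = eps ^ j2" using g0 by (simp add: P)
  also have "eps ^ j2 = eps ^ j1 * eps ^ (j2 - j1)" using j(2) by (simp flip: power_add)
  finally have "eps ^ (j2 - j1) = 1" using eps(2) by auto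
  then show ?thesis using that[of "j2 - j1"] j(2) by simp
qed

section \<open>Roots of unity in the cyclotomic ring\<close>

text \<open>With \<open>v\<close> of order \<open>N = M * L\<close>, \<open>eps\<close> is a power
  of \<open>v\<close>. An automorphism taking \<open>v\<close> to \<open>v ^ t\<close> with t = 1
  modulo \<open>M\<close> fixes Z[w], so \<open>eps ^ t = eps\<close>. Two such exponents that
  differ by exactly \<open>M\<close> give \<open>eps ^ M = 1\<close>.\<close>

lemma root_of_unity_int_adjoin_even:
  assumes w: "prim_root M w" and "even M" and eps: "eps \<in> int_adjoin w" "eps ^ L = 1" "L > 0"
  shows "eps ^ M = 1"
proof -
  note M = prim_rootD[OF w]
  define N where "N = M * L"
  define v where "v = cis (2 * pi / N)"
  have v: "prim_root N v" unfolding v_def using M(1) eps(3) by (intro prim_root_cis) (simp add: N_def)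
  have "prim_root M (v ^ L)" using prim_root_power_dvd v unfolding N_def .
  then obtain s where s: "w = (v ^ L) ^ s" using root_of_unity_eq_power M(2) by metis
  have "eps ^ N = 1" by (simp add: N_def mult.commute power_mult eps(2))
  then obtain k where k: "eps = v ^ k" using root_of_unity_eq_power[OF v] by metis
  obtain P where P: "eps = ipoly P w" using eps(1) by (elim int_adjoinE)
  have fixed: "eps ^ t = eps" if "coprime t N" "[t = 1] (mod M)" for t
  proof -
    define Q where "Q = pcompose P (monom 1 (L * s)) - monom 1 k"
    have "ipoly Q v = 0" using P k s by (simp add: Q_def power_mult)
    from ipoly_conjugate[OF v that(1) this]
    have "ipoly P ((v ^ t) ^ (L * s)) = eps ^ t"
      by (simp add: Q_def k power_mult[symmetric] mult_ac)
    moreover have "(v ^ t) ^ (L * s) = w ^ t" by (simp add: s power_mult[symmetric] mult_ac)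
    moreover have "w ^ t = w ^ 1" using prim_root_power_eq_iff[OF w] that(2) by blast
    ultimately show ?thesis by (simp add: P)
  qed
  \<comment> \<open>\<open>t\<close> is chosen to be 1 modulo \<open>M\<close> and \<open>M\<close>
    modulo every prime of \<open>L\<close> that does not divide \<open>M\<close>. At such a prime
    \<open>t\<close> and \<open>t + M\<close> are \<open>M\<close> and \<open>2 * M\<close>, both
    nonzero because the prime is odd, \<open>M\<close> being even.\<close>
  define L' where "L' = \<Prod>{p \<in> prime_factors L. \<not> p dvd M}"
  have "coprime M L'" unfolding L'_def
  proof (intro prod_coprime_right)
    fix p assume "p \<in> {p \<in> prime_factors L. \<not> p dvd M}"
    then have "coprime p M" by (intro prime_imp_coprime) auto
    then show "coprime M p" using coprime_commute by blast
  qed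
  then obtain x where "[M * x = 1] (mod L')" using cong_solve_coprime_nat[of M L'] by auto
  then have "[M * x * (M - 1) = 1 * (M - 1)] (mod L')" by (rule cong_scalar_right)
  then have *: "[1 + M * (x * (M - 1)) = 1 + (M - 1)] (mod L')"
    by (intro cong_add) (simp_all add: mult.assoc)
  define t where "t = 1 + M * (x * (M - 1))"
  have t: "[t = M] (mod L')" using * M(1) by (simp add: t_def)
  have cop: "coprime (t + M * i) N" if "i \<le> 1" for i
  proof (rule coprimeI_prime_nat)
    fix p assume p: "prime p" "p dvd t + M * i" "p dvd N"
    show False
    proof (cases "p dvd M")
      case True
      have "t + M * i = 1 + M * (x * (M - 1) + i)" by (simp add: t_def algebra_simps)
      then have "p dvd 1" using p(2) True by (metis dvd_add_left_iff dvd_mult2)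
      then show False using p(1) by simp
    next
      case False
      then have "p dvd L" using p by (simp add: N_def prime_dvd_mult_iff)
      then have "p dvd L'" unfolding L'_def using False p(1) eps(3)
        by (intro dvd_prodI[where f = "\<lambda>x. x", simplified]) (auto simp: prime_factors_dvd)
      then have "[t = M] (mod p)" using t cong_dvd_modulus_nat by blast
      then have "[t + M * i = M + M * i] (mod p)" by (intro cong_add) auto
      then have "p dvd M * (1 + i)" using p(2) by (simp add: cong_dvd_iff)
      then have "p dvd 1 + i" using False p(1) prime_dvd_mult_iff by blast
      then have "p \<le> 2" using that by (auto dest: dvd_imp_le)
      then have "p = 2" using prime_ge_2_nat[OF p(1)] by simp
      then show False using False \<open>even M\<close> by simp
    qed
  qed
  have t1: "[t + M * i = 1] (mod M)" for i
  proof -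
    have "t + M * i = 1 + M * (x * (M - 1) + i)" by (simp add: t_def algebra_simps)
    then show ?thesis by (simp only: cong_def mod_mult_self2)
  qed
  have "eps ^ (t + M * 1) = eps" by (intro fixed cop t1) simp
  moreover have "eps ^ (t + M * 0) = eps" by (intro fixed cop t1) simp
  ultimately have "eps * eps ^ M = eps" by (simp add: power_add)
  moreover have "eps \<noteq> 0" using eps by (auto simp: power_0_left)
  ultimately show ?thesis by simp
qed

text \<open>For odd \<open>M\<close>, \<open>- w\<close> is a primitive root of order
  \<open>2 * M\<close> and Z[-w] contains \<open>w\<close>, which reduces the claim to even
  order.\<close>

lemma root_of_unity_int_adjoin:
  assumes w: "prim_root M w" and eps: "eps \<in> int_adjoin w" "norm eps = 1"
  obtains k where "eps = w ^ k" | k where "odd M" "eps = - (w ^ k)"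
proof -
  note M = prim_rootD[OF w]
  obtain L where L: "L > 0" "eps ^ L = 1" using int_adjoin_norm_one_root_of_unity[OF w eps] by blast
  show ?thesis
  proof (cases "even M")
    case True
    then have "eps ^ M = 1" using root_of_unity_int_adjoin_even[OF w] eps L by blast
    then show ?thesis using root_of_unity_eq_power[OF w] that(1) by blast
  next
    case False
    define v where "v = - w"
    have v: "prim_root (2 * M) v" unfolding prim_root_def
    proof (intro conjI allI)
      fix j
      have "v ^ j = 1 \<longleftrightarrow> 2 * M dvd j"
      proof (cases "even j")
        case True
        then have "v ^ j = w ^ j" by (simp add: v_def)
        moreover have "2 * M dvd j \<longleftrightarrow> M dvd j" using True False
          by (metis coprime_commute coprime_left_2_iff_odd divides_mult dvd_mult_right)
        ultimately show ?thesis using M(3) by simp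
      next
        case odd: False
        have "v ^ j \<noteq> 1"
        proof
          assume "v ^ j = 1"
          then have "w ^ j = -1" using odd by (simp add: v_def equation_minus_iff)
          then have "(w ^ M) ^ j = (-1) ^ M" by (metis power_mult mult.commute)
          then show False using M(2) False by simp
        qed
        moreover have "\<not> 2 * M dvd j" using odd by (meson dvd_mult_left)
        ultimately show ?thesis by simp
      qed
      then show "v ^ j = 1 \<longleftrightarrow> 2 * M dvd j" .
    qed (use M in simp)
    have "w \<in> int_adjoin v" unfolding v_def using int_adjoin_uminus[OF int_adjoin_self, of "- w"] by simp
    then have "eps \<in> int_adjoin v" using eps(1) by (metis int_adjoinE int_adjoin_ipoly)
    then have "eps ^ (2 * M) = 1" using root_of_unity_int_adjoin_even[OF v] L by simp
    then obtain k where "eps = v ^ k" using root_of_unity_eq_power[OF v] by blast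
    then have "eps = w ^ k \<or> eps = - (w ^ k)" by (cases "even k") (auto simp: v_def)
    then show ?thesis using that False by blast
  qed
qed

section \<open>The prime above q in a cyclotomic ring\<close>

lemma pideal_prod:
  "(\<And>i. i \<in> A \<Longrightarrow> f i \<in> pideal w (g i)) \<Longrightarrow> (\<Prod>i\<in>A. f i) \<in> pideal w (\<Prod>i\<in>A. g i)"
  by (induction A rule: infinite_finite_induct) (auto intro: pideal_mult)

lemma one_minus_power_in_pideal:
  assumes "x \<in> int_adjoin w"
  shows "1 - x ^ j \<in> pideal w (1 - x)"
  unfolding one_diff_power_eq using assms by (intro pidealI) auto

text \<open>As \<open>j\<close> is invertible modulo \<open>N\<close>, \<open>x\<close> is a power
  of \<open>x ^ j\<close>, and a geometric sum gives the divisibility.\<close>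

lemma one_minus_prim_root_associated:
  assumes "prim_root N x" "x \<in> int_adjoin w" "coprime j N"
  shows "1 - x \<in> pideal w (1 - x ^ j)"
proof -
  obtain i where "[j * i = 1] (mod N)" using cong_solve_coprime_nat[OF assms(3)] by auto
  then have "(x ^ j) ^ i = x ^ 1"
    unfolding power_mult[symmetric] prim_root_power_eq_iff[OF assms(1)] .
  then show ?thesis using one_minus_power_in_pideal[of "x ^ j" w i] assms(2) by auto
qed

lemma prod_linear_prim_root:
  assumes "prim_root N x"
  shows "(\<Prod>j<N. [:- (x ^ j), 1:]) = monom 1 N - 1"
proof -
  note N = prim_rootD[OF assms]
  have inj: "inj_on (\<lambda>j. x ^ j) {..<N}"
    using prim_root_power_eq_iff[OF assms] by (auto simp: inj_on_def cong_def)
  have deg: "degree (monom 1 N - 1 :: complex poly) = N"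
    using N(1) by (subst diff_conv_add_uminus, subst degree_add_eq_left) (auto simp: degree_monom_eq)
  show ?thesis
  proof (rule poly_eqI_degree_lead_coeff[where n = N and A = "(\<lambda>j. x ^ j) ` {..<N}"])
    show "degree (\<Prod>j<N. [:- (x ^ j), 1:]) \<le> N"
      by (subst degree_prod_eq_sum_degree) auto
    have "degree (\<Prod>j<N. [:- (x ^ j), 1:]) = N"
      by (subst degree_prod_eq_sum_degree) auto
    moreover have "lead_coeff (\<Prod>j<N. [:- (x ^ j), 1:]) = 1"
      by (simp add: lead_coeff_prod)
    ultimately show "coeff (\<Prod>j<N. [:- (x ^ j), 1:]) N = coeff (monom 1 N - 1) N"
      using N(1) by simp
    show "card ((\<lambda>j. x ^ j) ` {..<N}) \<ge> N" using inj by (simp add: card_image)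
    fix z assume "z \<in> (\<lambda>j. x ^ j) ` {..<N}"
    then obtain j where j: "z = x ^ j" "j < N" by auto
    have "z ^ N = (x ^ N) ^ j" by (simp add: j power_mult[symmetric] mult.commute)
    then have "poly (monom 1 N - 1) z = 0" using N(2) by (simp add: poly_monom)
    moreover have "poly (\<Prod>j<N. [:- (x ^ j), 1:]) z = 0"
      using j by (auto simp: poly_prod prod_zero_iff)
    ultimately show "poly (\<Prod>j<N. [:- (x ^ j), 1:]) z = poly (monom 1 N - 1) z" by simp
  qed (use deg in simp)
qed

text \<open>This is the value at 1 of the cyclotomic polynomial of order q^(c+1). With N = q^c it is
  the quotient of x^(Nq) - 1 by x^N - 1, a sum of \<open>q\<close> powers of x^N.\<close>

lemma prod_one_minus_prim_root:
  assumes "prime q" "prim_root (q ^ Suc c) x"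
  shows "(\<Prod>j | j < q ^ Suc c \<and> \<not> q dvd j. 1 - x ^ j) = of_nat q"
proof -
  define N where "N = q ^ c"
  have q0: "q > 0" and N0: "N > 0" using assms(1) prime_gt_0_nat by (auto simp: N_def)
  have Nq: "q ^ Suc c = N * q" by (simp add: N_def)
  define A where "A = (\<Prod>j | j < N * q \<and> \<not> q dvd j. [:- (x ^ j), 1:])"
  define B where "B = (\<Prod>j<N. [:- ((x ^ q) ^ j), 1:])"
  have B: "B = monom 1 N - 1"
    unfolding B_def using assms(2) by (intro prod_linear_prim_root prim_root_power_dvd) (simp only: Nq)
  have "B = (\<Prod>j | j < N * q \<and> q dvd j. [:- (x ^ j), 1:])"
    unfolding B_def
    by (rule prod.reindex_bij_witness[of _ "\<lambda>j. j div q" "\<lambda>j. j * q"])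
      (use q0 in \<open>auto simp: power_mult[symmetric] mult.commute less_mult_imp_div_less\<close>)
  then have "A * B = (\<Prod>j\<in>{j. j < N * q \<and> \<not> q dvd j} \<union> {j. j < N * q \<and> q dvd j}. [:- (x ^ j), 1:])"
    unfolding A_def by (subst prod.union_disjoint) auto
  also have "{j. j < N * q \<and> \<not> q dvd j} \<union> {j. j < N * q \<and> q dvd j} = {..<N * q}" by auto
  also have "(\<Prod>j<N * q. [:- (x ^ j), 1:]) = monom 1 (N * q) - 1"
    using assms(2) by (intro prod_linear_prim_root) (simp only: Nq)
  also have "monom 1 (N * q) - 1 = (\<Sum>i<q. monom 1 N ^ i) * (monom 1 N - 1 :: complex poly)"
  proof -
    have "monom 1 (N * q) = (monom 1 N ^ q :: complex poly)" by (simp add: monom_power)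
    then show ?thesis by (simp only: power_diff_1_eq mult.commute)
  qed
  finally have "A * B = (\<Sum>i<q. monom 1 N ^ i) * B" by (simp only: B)
  moreover have "B \<noteq> 0"
    unfolding B_def by (auto simp: prod_zero_iff)
  ultimately have "A = (\<Sum>i<q. monom 1 N ^ i)" by simp
  then have "poly A 1 = of_nat q" by (simp add: poly_sum poly_monom poly_power)
  then show ?thesis unfolding A_def Nq by (simp add: poly_prod)
qed

text \<open>\<open>q\<close> is the product of the factors \<open>1 - x ^ j\<close>, each of which
  divides and is divided by \<open>1 - x\<close>; \<open>e\<close> is the number of these
  factors.\<close>

lemma prime_associated_uniformizer_power:
  assumes "prime q" "prim_root (q ^ Suc c) x" "x \<in> int_adjoin w"
  obtains e where "e > 0" "of_nat q \<in> pideal w ((1 - x) ^ e)" "(1 - x) ^ e \<in> pideal w (of_nat q)"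
proof -
  define J where "J = {j. j < q ^ Suc c \<and> \<not> q dvd j}"
  have fin: "finite J" by (simp add: J_def)
  have cop: "coprime j (q ^ Suc c)" if "j \<in> J" for j
    using that assms(1) prime_imp_coprime[of q j] unfolding J_def
    by (simp add: coprime_commute del: power_Suc)
  have "(\<Prod>j\<in>J. 1 - x ^ j) \<in> pideal w (\<Prod>j\<in>J. 1 - x)"
    by (intro pideal_prod one_minus_power_in_pideal assms)
  moreover have "(\<Prod>j\<in>J. 1 - x) \<in> pideal w (\<Prod>j\<in>J. 1 - x ^ j)"
    by (intro pideal_prod one_minus_prim_root_associated[OF assms(2,3)] cop)
  moreover have "1 \<in> J"
  proof -
    have "q > 1" using assms(1) by (rule prime_gt_1_nat)
    then have "1 < q ^ Suc c" by (intro one_less_power) auto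
    then show ?thesis using \<open>q > 1\<close> by (simp add: J_def)
  qed
  then have "card J > 0" using fin card_gt_0_iff by blast
  ultimately show ?thesis
    using that[of "card J"] prod_one_minus_prim_root[OF assms(1,2)] by (simp add: J_def)
qed

section \<open>Action of an automorphism at the primes above q\<close>

text \<open>Each \<open>q\<close>th power gains a factor \<open>d\<close>: in a^q - b^q = (a - b) S
  the sum S is congruent to q b^(q-1) modulo \<open>d\<close>, and \<open>d\<close> divides
  \<open>q\<close>.\<close>

lemma power_prime_lift_cong:
  assumes "of_nat q \<in> pideal w d" "d \<in> int_adjoin w" "x \<in> int_adjoin w" "y \<in> int_adjoin w"
    and "x - y \<in> pideal w d"
  shows "x ^ (q ^ k) - y ^ (q ^ k) \<in> pideal w (d ^ Suc k)"
proof (induction k)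
  case 0
  then show ?case using assms by simp
next
  case (Suc k)
  define a b where "a = x ^ (q ^ k)" and "b = y ^ (q ^ k)"
  have ab: "a \<in> int_adjoin w" "b \<in> int_adjoin w" using assms by (auto simp: a_def b_def)
  have "a - b \<in> pideal w d"
    unfolding a_def b_def using assms by (intro pideal_cong_power) auto
  then have i: "b ^ (q - Suc i) * a ^ i - b ^ (q - Suc i) * b ^ i \<in> pideal w d" for i
    using ab pideal_mult_left[OF pideal_cong_power[of a b w d i], of "b ^ (q - Suc i)"]
    by (auto simp: algebra_simps)
  have "(\<Sum>i<q. b ^ (q - Suc i) * a ^ i) - (\<Sum>i<q. b ^ (q - Suc i) * b ^ i) \<in> pideal w d"
    unfolding sum_subtractf[symmetric] by (intro pideal_sum i)
  moreover have "(\<Sum>i<q. b ^ (q - Suc i) * b ^ i) = of_nat q * b ^ (q - 1)"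
    by (simp flip: power_add)
  moreover have "of_nat q * b ^ (q - 1) \<in> pideal w d"
    using assms ab by (intro pideal_mult_right) auto
  ultimately have "(\<Sum>i<q. b ^ (q - Suc i) * a ^ i) \<in> pideal w d"
    using pideal_add by fastforce
  then have "(a - b) * (\<Sum>i<q. b ^ (q - Suc i) * a ^ i) \<in> pideal w (d ^ Suc k * d)"
    using Suc by (intro pideal_mult) (auto simp: a_def b_def)
  then have "a ^ q - b ^ q \<in> pideal w (d ^ Suc k * d)"
    by (simp only: power_diff_sumr2)
  then show ?case by (simp add: a_def b_def power_mult[symmetric] mult_ac)
qed

text \<open>Modulo \<open>1 - w ^ N\<close> exponents of \<open>w\<close> count only modulo
  \<open>N\<close>, so \<open>w ^ t\<close> may be replaced by \<open>w ^ (q ^ f)\<close>. The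
  Frobenius congruence modulo \<open>q\<close> then applies, because \<open>1 - w ^ N\<close>
  divides \<open>q\<close>.\<close>

lemma conjugate_cong_power:
  assumes q: "prime q" "of_nat q \<in> pideal w (1 - w ^ N)" and t: "[t = q ^ f] (mod N)"
  shows "ipoly P (w ^ t) - ipoly P w ^ (q ^ f) \<in> pideal w (1 - w ^ N)"
proof -
  have *: "v - v * (w ^ N) ^ j \<in> pideal w (1 - w ^ N)" if "v \<in> int_adjoin w" for j v
    using pideal_mult_left[OF one_minus_power_in_pideal[of "w ^ N" w j] that]
    by (auto simp: algebra_simps)
  obtain i j where ij: "t + N * i = q ^ f + N * j"
    using t unfolding cong_iff_lin_nat by (metis mult.commute)
  have "w ^ t - w ^ t * (w ^ N) ^ i \<in> pideal w (1 - w ^ N)" by (intro *) auto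
  moreover have "w ^ t * (w ^ N) ^ i = w ^ (q ^ f) * (w ^ N) ^ j"
    unfolding power_mult[symmetric] power_add[symmetric] ij ..
  moreover have "w ^ (q ^ f) * (w ^ N) ^ j - w ^ (q ^ f) \<in> pideal w (1 - w ^ N)"
    by (intro pideal_cong_sym[OF *]) auto
  ultimately have "w ^ t - w ^ (q ^ f) \<in> pideal w (1 - w ^ N)"
    using pideal_cong_trans by metis
  then have "ipoly P (w ^ t) - ipoly P (w ^ (q ^ f)) \<in> pideal w (1 - w ^ N)"
    by (intro pideal_cong_ipoly) auto
  moreover have "ipoly P (w ^ (q ^ f)) - ipoly P w ^ (q ^ f) \<in> pideal w (1 - w ^ N)"
    using pideal_trans[OF frobenius_power_cong[OF q(1), of P w f] q(2)]
    by (rule pideal_cong_sym)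
  ultimately show ?thesis by (rule pideal_cong_trans)
qed

text \<open>The automorphism \<open>w \<mapsto> w\<^sup>t\<close> acts as a power of Frobenius modulo \<open>\<pi> = 1 - w\<^sup>N\<close>, hence
  fixes the primes above \<open>q\<close>. The power \<open>E\<close> of \<open>X\<close> approximates the idempotent that is 1 at
  the primes not dividing \<open>X\<close>, and the automorphism preserves it up to high order; where \<open>E\<close>
  vanishes, a factor \<open>\<pi>\<close> splits off from \<open>X\<close>.\<close>

lemma conjugate_transfer_uniformizer_power:
  assumes w: "prim_root M w" and t: "coprime t M"
    and q: "prime q" "of_nat q \<in> pideal w (1 - w ^ N)" "coprime q N" "N > 0" "w ^ N \<noteq> 1"
    and tq: "[t = q ^ f] (mod N)"
    and Y: "Y \<in> int_adjoin w"
  shows "ipoly A w * Y \<in> pideal w ((1 - w ^ N) ^ B) \<Longrightarrow>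
      ipoly A (w ^ t) * Y \<in> pideal w ((1 - w ^ N) ^ B)"
proof (induction B arbitrary: A)
  case 0
  then show ?case using Y by auto
next
  case (Suc B)
  define d where "d = 1 - w ^ N"
  define F where "F = totient N"
  define s where "s = q ^ F - 1"
  define X where "X = ipoly A w"
  define Xt where "Xt = ipoly A (w ^ t)"
  define K where "K = s * q ^ B"
  define E where "E = X ^ K"
  define Et where "Et = Xt ^ K"
  have q1: "q > 1" using prime_gt_1_nat[OF q(1)] .
  have F: "F > 0" "[1 = q ^ F] (mod N)"
    using euler_theorem[OF q(3)] q(4) by (auto simp: F_def cong_sym)
  have "q ^ F > 1" using q1 F(1) by (rule one_less_power)
  then have s: "s > 0" "q ^ F = Suc s" by (auto simp: s_def)
  have K: "K > 0" using s q1 by (simp add: K_def)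
  have d0: "d \<noteq> 0" using q(5) by (simp add: d_def)
  have R: "d \<in> int_adjoin w" "X \<in> int_adjoin w" "Xt \<in> int_adjoin w" "E \<in> int_adjoin w"
      "Et \<in> int_adjoin w"
    by (auto simp: d_def X_def Xt_def E_def Et_def)
  \<comment> \<open>The identity automorphism has exponent 1, congruent to \<open>q ^ F\<close>
    modulo \<open>N\<close>. Hence \<open>X ^ Suc s\<close> is congruent to \<open>X\<close>, and
    \<open>X ^ s\<close> is idempotent modulo \<open>d\<close>.\<close>
  have X1: "X ^ Suc s - X \<in> pideal w d"
    using pideal_cong_sym[OF conjugate_cong_power[OF q(1,2) F(2), of A]]
    by (simp add: d_def X_def s(2))
  have X2: "X ^ (s * k + 1) - X \<in> pideal w d" for k
  proof (induction k)
    case (Suc k)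
    have "X ^ (s * k) * (X ^ Suc s - X) \<in> pideal w d"
      by (intro pideal_mult_left X1 int_adjoin_power R)
    from pideal_add[OF this Suc] show ?case by (simp add: algebra_simps power_add)
  qed simp
  have X3: "X ^ (s * k) - X ^ s \<in> pideal w d" if "k > 0" for k
  proof -
    have "X ^ (s - 1) * (X ^ (s * (k - 1) + 1) - X) \<in> pideal w d"
      by (intro pideal_mult_left X2 int_adjoin_power R)
    moreover have "X ^ (s - 1) * X ^ (s * (k - 1) + 1) = X ^ (s * k)"
    proof -
      have "s - 1 + (s * (k - 1) + 1) = s * k" using s(1) that by (cases k) auto
      then show ?thesis by (simp only: power_add[symmetric])
    qed
    moreover have "X ^ (s - 1) * X = X ^ s" using s(1) by (simp flip: power_Suc2)
    ultimately show ?thesis by (simp only: right_diff_distrib)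
  qed
  have "Xt - X ^ (q ^ f) \<in> pideal w d"
    unfolding Xt_def X_def d_def by (rule conjugate_cong_power[OF q(1,2) tq])
  then have "Xt ^ s - (X ^ (q ^ f)) ^ s \<in> pideal w d" by (intro pideal_cong_power R int_adjoin_power)
  moreover have "(X ^ (q ^ f)) ^ s - X ^ s \<in> pideal w d"
    using X3[of "q ^ f"] q1 by (simp add: power_mult[symmetric] mult.commute)
  ultimately have "Xt ^ s - X ^ s \<in> pideal w d" by (rule pideal_cong_trans)
  \<comment> \<open>Raising to the power \<open>q ^ B\<close> sharpens the congruence modulo
    \<open>d\<close> to one modulo \<open>d ^ Suc B\<close>.\<close>
  then have "(Xt ^ s) ^ (q ^ B) - (X ^ s) ^ (q ^ B) \<in> pideal w (d ^ Suc B)"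
    using q(2) by (intro power_prime_lift_cong R int_adjoin_power) (simp_all add: d_def)
  then have EtE: "Et - E \<in> pideal w (d ^ Suc B)"
    by (simp add: Et_def E_def K_def power_mult)
  have XY: "X * Y \<in> pideal w (d ^ Suc B)" using Suc.prems by (simp add: X_def d_def)
  have "X - E * X \<in> pideal w d"
    using pideal_cong_sym[OF X2[of "q ^ B"]] by (simp add: E_def K_def mult.commute)
  \<comment> \<open>The induction hypothesis will be applied to \<open>A'\<close>: multiplying (1 -
    E) X = d A'(w) by \<open>Y\<close> and cancelling \<open>d\<close> lowers the exponent to
    \<open>B\<close>.\<close>
  then obtain A' where A': "X - E * X = d * ipoly A' w" by (elim pidealE int_adjoinE) blast
  have "ipoly (A - A ^ K * A - (1 - monom 1 N) * A') w = 0"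
    using A' by (simp add: X_def E_def d_def)
  from ipoly_conjugate[OF w t this]
  have "Xt - Et * Xt = (1 - (w ^ t) ^ N) * ipoly A' (w ^ t)"
    by (simp add: Xt_def Et_def)
  also have "(w ^ t) ^ N = (w ^ N) ^ t" by (simp add: power_mult[symmetric] mult.commute)
  finally have Xt1: "Xt - Et * Xt = (1 - (w ^ N) ^ t) * ipoly A' (w ^ t)" .
  have "d * (ipoly A' w * Y) = (1 - E) * (X * Y)"
    unfolding mult.assoc[symmetric] A'[symmetric] by (simp add: algebra_simps)
  also have "\<dots> \<in> pideal w (d * d ^ B)"
    using pideal_mult_left[OF XY, of "1 - E"] R by auto
  finally have "ipoly A' w * Y \<in> pideal w (d ^ B)" using d0 by (rule pideal_cancel)
  then have "ipoly A' (w ^ t) * Y \<in> pideal w (d ^ B)" using Suc.IH by (simp add: d_def)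
  moreover have "1 - (w ^ N) ^ t \<in> pideal w d"
    unfolding d_def by (intro one_minus_power_in_pideal) auto
  ultimately have "(1 - (w ^ N) ^ t) * (ipoly A' (w ^ t) * Y) \<in> pideal w (d * d ^ B)"
    by (intro pideal_mult)
  then have 1: "(Xt - Et * Xt) * Y \<in> pideal w (d ^ Suc B)" by (simp add: Xt1 mult.assoc)
  have 2: "(Et - E) * (Xt * Y) \<in> pideal w (d ^ Suc B)"
    using EtE R Y by (intro pideal_mult_right) auto
  have "E * Y = X ^ (K - 1) * (X * Y)"
    using K by (simp add: E_def power_eq_if)
  then have "E * Y \<in> pideal w (d ^ Suc B)"
    by (simp only: pideal_mult_left XY int_adjoin_power R)
  then have 3: "Xt * (E * Y) \<in> pideal w (d ^ Suc B)" using R(3) by (rule pideal_mult_left)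
  have "Xt * Y = (Xt - Et * Xt) * Y + (Et - E) * (Xt * Y) + Xt * (E * Y)"
    by (simp add: algebra_simps)
  also have "\<dots> \<in> pideal w (d ^ Suc B)" using 1 2 3 by (intro pideal_add)
  finally show ?case by (simp add: Xt_def d_def)
qed

text \<open>For the part \<open>N\<close> of \<open>M\<close> prime to \<open>q\<close>,
  \<open>w ^ N\<close> has order a power of \<open>q\<close>. Hence \<open>q\<close> and a power
  \<open>(1 - w ^ N) ^ e\<close> divide each other, and divisibility by \<open>q ^ b\<close> means
  divisibility by \<open>(1 - w ^ N) ^ (e * b)\<close>.\<close>

lemma conjugate_transfer_prime_power:
  assumes w: "prim_root M w" and t: "coprime t M"
    and q: "prime q" "q dvd M"
    and tq: "[t = q ^ f] (mod M div q ^ multiplicity q M)"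
    and Y: "Y \<in> int_adjoin w" and AY: "ipoly A w * Y \<in> pideal w (of_nat (q ^ b))"
  shows "ipoly A (w ^ t) * Y \<in> pideal w (of_nat (q ^ b))"
proof -
  note M = prim_rootD[OF w]
  define N where "N = M div q ^ multiplicity q M"
  have MN: "M = q ^ multiplicity q M * N" by (simp add: N_def multiplicity_dvd)
  have "multiplicity q M > 0"
    using q M(1) by (simp add: prime_multiplicity_gt_zero_iff)
  then obtain c where c: "multiplicity q M = Suc c" by (metis gr0_conv_Suc)
  have N0: "N > 0" using M(1) MN by (metis gr0I mult_0_right)
  have cop: "coprime q N"
  proof -
    have "\<not> q dvd N" unfolding N_def using q M(1) multiplicity_decompose[of M q] not_prime_unit
      by blast
    then show ?thesis using q(1) by (simp add: prime_imp_coprime)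
  qed
  have x: "prim_root (q ^ Suc c) (w ^ N)" using w MN by (intro prim_root_power_dvd) (simp add: c)
  obtain e where e: "e > 0" "of_nat q \<in> pideal w ((1 - w ^ N) ^ e)"
      "(1 - w ^ N) ^ e \<in> pideal w (of_nat q)"
    using prime_associated_uniformizer_power[OF q(1) x, of w] by auto
  have q': "of_nat q \<in> pideal w (1 - w ^ N)"
  proof (rule pideal_trans[OF e(2)])
    have "(1 - w ^ N) ^ e = (1 - w ^ N) * (1 - w ^ N) ^ (e - 1)" using e(1) by (simp add: power_eq_if)
    moreover have "(1 - w ^ N) ^ (e - 1) \<in> int_adjoin w" by (intro int_adjoin_power int_adjoin_diff) auto
    ultimately show "(1 - w ^ N) ^ e \<in> pideal w (1 - w ^ N)" by (simp only: pidealI)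
  qed
  have w1: "w ^ N \<noteq> 1"
  proof
    assume "w ^ N = 1"
    then have "(w ^ N) ^ 1 = 1" by simp
    then have "q ^ Suc c dvd 1" using prim_rootD(3)[OF x] by blast
    then show False using q(1) by simp
  qed
  have "ipoly A w * Y \<in> pideal w ((1 - w ^ N) ^ (e * b))"
    using pideal_trans[OF AY] pideal_power[OF e(2), of b] by (simp add: power_mult)
  then have "ipoly A (w ^ t) * Y \<in> pideal w ((1 - w ^ N) ^ (e * b))"
    using conjugate_transfer_uniformizer_power[OF w t q(1) q' cop N0 w1 tq[folded N_def] Y] by blast
  then show ?thesis
    using pideal_trans pideal_power[OF e(3), of b] by (simp add: power_mult)
qed

text \<open>With \<open>\<sigma>: w \<mapsto> w\<^sup>t\<close> and \<open>Y = A(w)\<close>, the quotient \<open>\<sigma>(Y)/Y\<close> is integral at all primes above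
  \<open>n\<close> and has absolute value 1, so Kronecker's theorem applies.\<close>

lemma conjugate_eq_root_of_unity_times:
  assumes w: "prim_root M w" and t: "coprime t M"
    and n: "n > 0" "\<And>q. prime q \<Longrightarrow> q dvd n \<Longrightarrow> q dvd M"
    and tq: "\<And>q. prime q \<Longrightarrow> q dvd n \<Longrightarrow> \<exists>f. [t = q ^ f] (mod M div q ^ multiplicity q M)"
    and Y: "ipoly A w * cnj (ipoly A w) = of_nat n"
  obtains k where "ipoly A (w ^ t) = w ^ k * ipoly A w"
    | k where "odd M" "ipoly A (w ^ t) = - (w ^ k) * ipoly A w"
proof -
  note M = prim_rootD[OF w]
  define y where "y = ipoly A w"
  define z where "z = ipoly A (w ^ t)"
  have cnjR: "cnj y \<in> int_adjoin w"
    by (auto simp: y_def cnj_ipoly prim_root_cnj[OF w])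
  \<comment> \<open>Since \<open>y * cnj y\<close> equals \<open>n\<close>, the quotient of
    \<open>z\<close> by \<open>y\<close> is that of \<open>z * cnj y\<close> by \<open>n\<close>.
    Its integrality is obtained by transferring the divisibility of \<open>y * cnj y\<close> prime
    by prime.\<close>
  have "z * cnj y \<in> pideal w (of_nat n)"
  proof (rule pideal_prime_powers_combine[OF n(1)])
    fix q assume q: "prime q" "q dvd n"
    then obtain f where f: "[t = q ^ f] (mod M div q ^ multiplicity q M)" using tq by blast
    have "y * cnj y \<in> pideal w (of_nat (q ^ multiplicity q n))"
    proof -
      obtain j where "n = q ^ multiplicity q n * j" using multiplicity_dvd[of q n] by (elim dvdE)
      then have "y * cnj y = of_nat (q ^ multiplicity q n) * of_nat j"
        using Y unfolding y_def by (metis of_nat_mult)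
      then show ?thesis by auto
    qed
    then show "z * cnj y \<in> pideal w (of_nat (q ^ multiplicity q n))"
      unfolding z_def y_def
      using conjugate_transfer_prime_power[OF w t q(1) n(2)[OF q] f cnjR] by (simp add: y_def)
  qed (use cnjR in \<open>auto simp: z_def\<close>)
  then obtain eps where eps: "eps \<in> int_adjoin w" "z * cnj y = of_nat n * eps" by (elim pidealE)
  have n0: "(of_nat n :: complex) \<noteq> 0" using n(1) by simp
  have "of_nat n * z = (z * cnj y) * y" using Y by (simp add: y_def mult_ac)
  then have zy: "z = eps * y" using n0 by (simp add: eps(2) mult.assoc)
  have "z * cnj z = of_nat n"
  proof -
    define Q where "Q = A * pcompose A (monom 1 (M - 1)) - [:int n:]"
    have "ipoly Q w = 0" using Y by (simp add: Q_def cnj_ipoly prim_root_cnj[OF w])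
    then have "ipoly Q (w ^ t) = 0" by (rule ipoly_conjugate[OF w t])
    moreover have "cnj (w ^ t) = (w ^ t) ^ (M - 1)"
      by (simp add: prim_root_cnj[OF w] power_mult[symmetric] mult.commute)
    ultimately show ?thesis by (simp add: Q_def z_def cnj_ipoly)
  qed
  then have "of_nat n * (eps * cnj eps) = of_nat n" using Y by (simp add: zy y_def mult_ac)
  then have "eps * cnj eps = 1" using n0 by simp
  then have "complex_of_real ((norm eps)\<^sup>2) = 1" by (simp only: complex_norm_square)
  then have "(norm eps)\<^sup>2 = 1" by (simp only: of_real_eq_1_iff)
  then have "norm eps = 1" by (simp add: power2_eq_1_iff) (smt (verit) norm_ge_zero)
  from root_of_unity_int_adjoin[OF w eps(1) this] show ?thesis
    using that zy unfolding z_def y_def by metis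
qed

section \<open>Powers of q congruent to 1 + M/p\<close>

lemma cong_one_power_prime_power:
  fixes a :: int and p :: nat
  assumes "[a = 1] (mod int p)"
  shows "[a ^ (p ^ k) = 1] (mod int p ^ Suc k)"
proof (induction k)
  case 0
  then show ?case using assms by simp
next
  case (Suc k)
  define b where "b = a ^ (p ^ k)"
  have "[b = 1 ^ (p ^ k)] (mod int p)" unfolding b_def using assms by (rule cong_pow)
  then have "[(\<Sum>i<p. b ^ i) = (\<Sum>i<p. 1 ^ i)] (mod int p)" by (intro cong_sum cong_pow) simp
  then have "int p dvd (\<Sum>i<p. b ^ i)" by (simp add: cong_dvd_iff)
  moreover have "int p ^ Suc k dvd b - 1" using Suc by (simp add: b_def cong_iff_dvd_diff)
  ultimately have "int p ^ Suc k * int p dvd (b - 1) * (\<Sum>i<p. b ^ i)" by (intro mult_dvd_mono)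
  then have "int p ^ Suc k * int p dvd b ^ p - 1" by (simp only: power_diff_1_eq)
  then show ?case by (simp add: b_def cong_iff_dvd_diff power_mult[symmetric] mult_ac)
qed

lemma one_plus_power_cong:
  fixes u :: int
  shows "[(1 + u) ^ e = 1 + int e * u] (mod u ^ 2)"
proof (induction e)
  case (Suc e)
  have "[(1 + u) * (1 + u) ^ e = (1 + u) * (1 + int e * u)] (mod u ^ 2)"
    using Suc by (rule cong_scalar_left)
  also have "(1 + u) * (1 + int e * u) = 1 + int (Suc e) * u + u ^ 2 * int e"
    by (simp add: algebra_simps power2_eq_square)
  also have "[\<dots> = 1 + int (Suc e) * u] (mod u ^ 2)" by (simp add: cong_def)
  finally show ?case by simp
qed simp

text \<open>With b = 1 + p y the sum is p + p y p(p-1)/2 modulo p^2, and (p-1)/2 is an integer for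
  odd \<open>p\<close>. So (b^p - 1)/(b - 1) contains \<open>p\<close> exactly once.\<close>

lemma geometric_sum_cong_prime_square:
  fixes b :: int
  assumes p: "prime p" and b: "[b = 1] (mod int p)" "p = 2 \<Longrightarrow> [b = 1] (mod 4)"
  shows "[(\<Sum>i<p. b ^ i) = int p] (mod (int p)\<^sup>2)"
proof (cases "p = 2")
  case True
  have "[1 + b = 1 + 1] (mod 4)" using b(2)[OF True] by (intro cong_add) auto
  moreover have "(\<Sum>i<2. b ^ i) = 1 + b" by (simp add: numeral_2_eq_2)
  moreover have "(2 :: int)\<^sup>2 = 4" by simp
  ultimately show ?thesis by (simp only: True of_nat_numeral one_add_one)
next
  case False
  then have "odd p" using prime_ge_2_nat[OF p] prime_odd_nat[OF p] by simp
  then obtain r where r: "p = 2 * r + 1" by (elim oddE)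
  obtain y where y: "b = 1 + int p * y"
    using b(1) by (metis cong_iff_lin cong_sym)
  have "[b ^ i = 1 + int i * (int p * y)] (mod (int p)\<^sup>2)" for i
    using one_plus_power_cong[of "int p * y" i] unfolding y
    by (rule cong_dvd_modulus) (simp add: power_mult_distrib)
  then have "[(\<Sum>i<p. b ^ i) = (\<Sum>i<p. 1 + int i * (int p * y))] (mod (int p)\<^sup>2)"
    by (intro cong_sum)
  also have "(\<Sum>i<p. 1 + int i * (int p * y)) = int p + (\<Sum>i<p. int i) * (int p * y)"
    by (simp add: sum.distrib sum_distrib_right)
  also have "(\<Sum>i<p. int i) = int p * int r"
  proof -
    have "(\<Sum>i<n. int i) * 2 = int n * (int n - 1)" for n by (induction n) (auto simp: algebra_simps)
    from this[of p] show ?thesis by (simp add: r)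
  qed
  also have "int p + int p * int r * (int p * y) = int p + (int p)\<^sup>2 * (int r * y)"
    by (simp add: power2_eq_square)
  also have "[\<dots> = int p] (mod (int p)\<^sup>2)" by (simp add: cong_def)
  finally show ?thesis .
qed

text \<open>The subgroup of the units modulo \<open>N\<close> generated by \<open>a\<close> contains an element \<open>b\<close> of order \<open>p\<close>;
  since \<open>b\<close> is 1 modulo each prime divisor of \<open>N\<close>, it has the form \<open>1 + j N/p\<close>.\<close>

lemma exists_power_cong_one_plus:
  fixes a N p v :: nat
  assumes p: "prime p" and N: "N > 0" "p ^ Suc v dvd N" and "coprime a N"
    and a1: "\<And>l. prime l \<Longrightarrow> l dvd N \<Longrightarrow> [a = 1] (mod l)" and a4: "p = 2 \<Longrightarrow> [a = 1] (mod 4)"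
    and av: "\<not> [a = 1] (mod p ^ Suc v)"
  shows "\<exists>f. [a ^ f = 1 + (N div p) * r] (mod N)"
proof -
  have pN: "p dvd N" using dvd_trans[OF _ N(2), of p] by simp
  have "v > 0" using av a1[OF p pN] by (cases v) auto
  then have "p ^ 2 dvd p ^ Suc v" by (intro le_imp_power_dvd) auto
  then have p2N: "p ^ 2 dvd N" using N(2) dvd_trans by blast
  define T where "T = ord N a"
  have T0: "T > 0" using \<open>coprime a N\<close> by (simp add: T_def coprime_commute)
  have pT: "p dvd T"
  proof (rule ccontr)
    \<comment> \<open>The order of \<open>a\<close> modulo \<open>p ^ Suc v\<close> divides both
      \<open>T\<close> and \<open>p ^ v\<close>, so it would be 1, against
      \<open>av\<close>.\<close>
    assume "\<not> p dvd T"
    then have "coprime (p ^ v) T" using p by (simp add: prime_imp_coprime)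
    moreover have "ord (p ^ Suc v) a dvd T"
      using ord[of a N] N(2) cong_dvd_modulus_nat ord_divides unfolding T_def by blast
    moreover have "ord (p ^ Suc v) a dvd p ^ v"
    proof -
      have "[int a = int 1] (mod int p)" using a1[OF p pN] by (simp only: cong_int_iff)
      then have "[int a ^ (p ^ v) = 1] (mod int p ^ Suc v)" by (intro cong_one_power_prime_power) simp
      then have "[int (a ^ (p ^ v)) = int 1] (mod int (p ^ Suc v))" by simp
      then have "[a ^ (p ^ v) = 1] (mod p ^ Suc v)" by (simp only: cong_int_iff)
      then show ?thesis by (simp only: ord_divides)
    qed
    ultimately have "ord (p ^ Suc v) a dvd 1" by (metis coprime_common_divisor)
    then have "[a ^ 1 = 1] (mod p ^ Suc v)" by (simp only: ord_divides)
    then show False using av by simp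
  qed
  define b where "b = a ^ (T div p)"
  have b1: "[b = 1] (mod l)" if "[a = 1] (mod l)" for l
    using cong_pow[OF that, of "T div p"] by (simp add: b_def)
  have bp: "[b ^ p = 1] (mod N)"
    using ord[of a N] pT by (simp add: b_def T_def power_mult[symmetric])
  have bN: "\<not> [b = 1] (mod N)"
    unfolding b_def
  proof (rule ord_minimal)
    show "0 < T div p" using T0 pT by (metis dvd_div_eq_0_iff gr0I)
    show "T div p < ord N a" using T0 prime_gt_1_nat[OF p] by (simp add: T_def)
  qed
  \<comment> \<open>\<open>S\<close> is the quotient of b^p - 1 by b - 1. It is \<open>p\<close>
    times a number coprime to \<open>N\<close>, so \<open>N\<close> dividing
    \<open>(b - 1) * S\<close> leaves \<open>N div p\<close> dividing \<open>b - 1\<close>.\<close>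
  define S where "S = (\<Sum>i<p. int b ^ i)"
  have Sp2: "[S = int p] (mod (int p)\<^sup>2)" unfolding S_def
  proof (rule geometric_sum_cong_prime_square[OF p])
    show "[int b = 1] (mod int p)" using b1[OF a1[OF p pN]] by (metis cong_int_iff of_nat_1)
    show "[int b = 1] (mod 4)" if "p = 2" using b1[OF a4[OF that]] by (metis cong_int_iff of_nat_1 of_nat_numeral)
  qed
  then have "int p dvd S" by (metis cong_dvd_iff cong_dvd_modulus dvd_refl dvd_triv_left power2_eq_square)
  then obtain S' where S': "S = int p * S'" by (elim dvdE)
  have copS: "coprime S' (int N)"
  proof (rule ccontr)
    assume "\<not> coprime S' (int N)"
    then obtain c where c: "c dvd S'" "c dvd int N" "\<not> is_unit c" by (auto simp: coprime_def)
    have "c \<noteq> 0" using c(2) N(1) by auto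
    then obtain l' where l': "prime l'" "l' dvd c" using c(3) prime_divisorE by blast
    then obtain l where l: "l' = int l" "prime l" by (metis prime_int_nat_transfer nat_0_le prime_ge_0_int)
    have lN: "l dvd N" and lS: "int l dvd S'" 
      using dvd_trans[OF l'(2) c(2)] dvd_trans[OF l'(2) c(1)] by (simp_all add: l(1))
    show False
    proof (cases "l = p")
      case True
      have "int p * int p dvd int p * (S' - 1)"
        using Sp2 by (simp add: S' cong_iff_dvd_diff power2_eq_square right_diff_distrib)
      then have "int p dvd S' - 1" using p by (simp add: prime_gt_0_nat)
      then have "int p dvd S' - (S' - 1)" using lS unfolding True by (rule dvd_diff[rotated])
      then show False using p by simp
    next
      case False
      have "[int b = 1] (mod int l)" using b1[OF a1[OF l(2) lN]] by (metis cong_int_iff of_nat_1)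
      then have "[S = (\<Sum>i<p. 1 ^ i)] (mod int l)" unfolding S_def by (intro cong_sum cong_pow)
      then have "int l dvd S \<longleftrightarrow> int l dvd int p" by (simp add: cong_dvd_iff)
      then have "int l dvd int p" using lS by (simp add: S')
      then show False using False p l(2) by (simp add: primes_dvd_imp_eq)
    qed
  qed
  have "int N dvd (int b - 1) * S"
    using bp by (metis S_def cong_iff_dvd_diff cong_int_iff of_nat_1 of_nat_power power_diff_1_eq)
  then have "int N dvd (int p * (int b - 1)) * S'" by (simp add: S' mult_ac)
  then have "int N dvd int p * (int b - 1)" using copS by (simp add: coprime_dvd_mult_left_iff coprime_commute)
  moreover define N' where "N' = N div p"
  have N': "N = p * N'" using pN by (simp add: N'_def)
  ultimately have "int N' dvd int b - 1" using p by (simp add: prime_gt_0_nat)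
  then obtain j where j: "int b = 1 + int N' * j" by (metis add.commute diff_add_cancel dvdE)
  have "coprime j (int p)"
  proof (rule ccontr)
    assume "\<not> coprime j (int p)"
    then have "int p dvd j" using p prime_imp_coprime[of "int p" j] coprime_commute by auto
    then have "int N dvd int b - 1" by (simp add: j N' mult.commute)
    then have "[b = 1] (mod N)" by (metis cong_iff_dvd_diff cong_int_iff of_nat_1)
    then show False using bN by simp
  qed
  then obtain x where x: "[j * x = 1] (mod int p)" using cong_solve_coprime_int by blast
  \<comment> \<open>Powers of 1 + j N/p add up the multiples of N/p, because \<open>N\<close>
    divides the square of N/p. So \<open>e\<close> solves j e = r modulo \<open>p\<close>.\<close>
  define e where "e = nat ((x * int r) mod int p)"
  have e: "int e = (x * int r) mod int p" using p by (simp add: e_def prime_gt_0_nat)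
  have "[j * int e = j * (x * int r)] (mod int p)" unfolding e by (intro cong_mult) (auto simp: cong_def)
  also have "[j * (x * int r) = int r] (mod int p)"
    using cong_scalar_right[OF x, of "int r"] by (simp add: mult.assoc)
  finally have "[int N' * (j * int e) = int N' * int r] (mod int N' * int p)" by (rule cong_cmult_leftI)
  then have je: "[1 + int e * (int N' * j) = 1 + int N' * int r] (mod int N)"
    by (intro cong_add) (simp_all add: N' mult_ac)
  have "[int b ^ e = 1 + int e * (int N' * j)] (mod (int N' * j)\<^sup>2)"
    unfolding j by (rule one_plus_power_cong)
  moreover have "int N dvd (int N' * j)\<^sup>2"
  proof -
    have "p dvd N'" using p2N p by (simp add: N' power2_eq_square prime_gt_0_nat)
    then have "N dvd N'\<^sup>2" by (simp add: N' power2_eq_square)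
    then have "int N dvd (int N')\<^sup>2" by (metis int_dvd_int_iff of_nat_power)
    then show ?thesis by (simp add: power_mult_distrib)
  qed
  ultimately have "[int b ^ e = 1 + int e * (int N' * j)] (mod int N)" by (rule cong_dvd_modulus)
  from cong_trans[OF this je] have "[int (b ^ e) = int (1 + N' * r)] (mod int N)" by simp
  then have "[b ^ e = 1 + N' * r] (mod N)" by (simp only: cong_int_iff)
  then show ?thesis unfolding b_def N'_def power_mult[symmetric] by blast
qed

section \<open>The descent\<close>

text \<open>The cross term contains (M/p)^2, a multiple of \<open>M\<close>. Hence composing
  automorphisms with exponents 1 + j M/p adds the values of j.\<close>

lemma one_plus_cofactor_cong:
  fixes M p :: nat
  assumes "p\<^sup>2 dvd M"
  shows "[(1 + i * (M div p)) * (1 + j * (M div p)) = 1 + (i + j) * (M div p)] (mod M)"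
proof -
  obtain r where r: "M = p * p * r" using assms by (auto simp: power2_eq_square)
  show ?thesis
  proof (cases "p = 0")
    case False
    then have "M div p = p * r" by (simp add: r)
    then have "(1 + i * (M div p)) * (1 + j * (M div p)) = 1 + (i + j) * (M div p) + M * (i * j * r)"
      by (simp add: r algebra_simps)
    then show ?thesis by (simp add: cong_def)
  qed (simp add: r)
qed

lemma coprime_one_plus_cofactor:
  fixes M p :: nat
  assumes "\<And>l. prime l \<Longrightarrow> l dvd M \<Longrightarrow> l dvd M div p"
  shows "coprime (1 + j * (M div p)) M"
proof (rule coprimeI_prime_nat)
  fix l assume l: "prime l" "l dvd 1 + j * (M div p)" "l dvd M"
  then have "l dvd j * (M div p)" using assms by auto
  then have "l dvd 1" using l(2) dvd_add_left_iff by blast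
  then show False using l(1) by simp
qed

text \<open>The \<open>b v\<close> are powers of \<open>w ^ (M div h)\<close>, and \<open>M\<close>
  divides (M/p)(M/h), so exponents 1 + j M/p fix them. The other factors pick up powers of one
  \<open>p\<close>th root of unity. A single \<open>A\<close> serves for all j.\<close>

lemma twisted_sum_conjugates:
  fixes b :: "nat \<Rightarrow> complex"
  assumes w: "prim_root M w" and hp: "h * p dvd M" "h > 0" "p > 0" and N: "N dvd M"
    and b: "\<And>v. b v ^ h = 1"
  obtains A where "\<And>j. ipoly A (w ^ (1 + j * (M div p)))
      = (\<Sum>v<N. b v * (w ^ (M div N)) ^ v * (w ^ (M div p * (M div N))) ^ (j * v))"
proof -
  note M = prim_rootD[OF w]
  have hM: "h dvd M" using hp(1) by (rule dvd_mult_left)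
  have "prim_root h (w ^ (M div h))" using w hM by (intro prim_root_power_dvd) simp
  then have "\<exists>s. b v = (w ^ (M div h)) ^ s" for v
    using root_of_unity_eq_power b by metis
  then obtain s where s: "b v = (w ^ (M div h)) ^ s v" for v by metis
  define A where "A = (\<Sum>v<N. monom 1 (M div h * s v + M div N * v) :: int poly)"
  have sum: "ipoly (\<Sum>v\<in>V. f v) x = (\<Sum>v\<in>V. ipoly (f v) x)" for V :: "nat set" and f x
    by (induction V rule: infinite_finite_induct) auto
  show ?thesis
  proof (rule that[of A])
    fix j
    have "(w ^ (1 + j * (M div p))) ^ (M div h * s v + M div N * v)
        = b v * (w ^ (M div N)) ^ v * (w ^ (M div p * (M div N))) ^ (j * v)" for v
    proof -
      obtain r where r: "M = h * p * r" using hp(1) by (elim dvdE)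
      have "M div p * (M div h) = M * r" using hp by (simp add: r)
      then have "w ^ (j * (M div p) * (M div h * s v)) = (w ^ M) ^ (j * r * s v)"
        by (simp add: power_mult[symmetric] mult_ac)
      then have e1: "w ^ (j * (M div p) * (M div h * s v)) = 1" by (simp add: M(2))
      have "(w ^ (1 + j * (M div p))) ^ (M div h * s v + M div N * v)
          = w ^ ((1 + j * (M div p)) * (M div h * s v + M div N * v))"
        by (rule power_mult[symmetric])
      also have "(1 + j * (M div p)) * (M div h * s v + M div N * v)
          = M div h * s v + M div N * v + M div p * (M div N) * (j * v)
            + j * (M div p) * (M div h * s v)"
        by (simp add: algebra_simps)
      also have "w ^ \<dots> = w ^ (M div h * s v + M div N * v + M div p * (M div N) * (j * v))"
        unfolding power_add[of w "M div h * s v + M div N * v + M div p * (M div N) * (j * v)"] e1 by simp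
      also have "\<dots> = b v * (w ^ (M div N)) ^ v * (w ^ (M div p * (M div N))) ^ (j * v)"
        by (simp only: power_add power_mult s)
      finally show ?thesis .
    qed
    then show "ipoly A (w ^ (1 + j * (M div p)))
      = (\<Sum>v<N. b v * (w ^ (M div N)) ^ v * (w ^ (M div p * (M div N))) ^ (j * v))"
      by (simp only: A_def sum ipoly_monom of_int_1 mult_1_left)
  qed
qed

text \<open>The automorphism multiplies \<open>Y\<close> by a root of unity \<open>eps\<close>. If
  \<open>eps ^ p = 1\<close>, \<open>Y\<close> lies in an eigenspace, which is the first
  alternative; the only other possibility is \<open>p = 2\<close> with \<open>eps\<close> a square
  root of -1.\<close>

lemma descent_step:
  fixes b :: "nat \<Rightarrow> complex"
  assumes w: "prim_root M w" and p: "prime p" "coprime p (M div N)"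
    and hp: "h * p dvd M" "h > 0" and N: "N dvd M"
    and hM: "\<And>l. prime l \<Longrightarrow> l dvd M \<Longrightarrow> l dvd h"
    and b: "\<And>v. b v ^ h = 1"
    and n: "n > 0" "\<And>q. prime q \<Longrightarrow> q dvd n \<Longrightarrow> q dvd M"
    and tq: "\<And>q. prime q \<Longrightarrow> q dvd n \<Longrightarrow>
        \<exists>f. [1 + M div p = q ^ f] (mod M div q ^ multiplicity q M)"
    and Y: "Y = (\<Sum>v<N. b v * (w ^ (M div N)) ^ v)" "Y * cnj Y = of_nat n"
  obtains y where "y < p" "Y = (\<Sum>v | v < N \<and> v mod p = y. b v * (w ^ (M div N)) ^ v)"
    | eps where "p = 2" "\<not> 8 dvd M" "eps\<^sup>2 = -1"
        "(\<Sum>v<N. b v * (w ^ (M div N)) ^ v * (-1) ^ v) = eps * Y"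
proof -
  note M = prim_rootD[OF w]
  have p0: "p > 0" using p(1) by (rule prime_gt_0_nat)
  have pM: "p dvd M" using hp(1) by (rule dvd_mult_right)
  have hMp: "h dvd M div p" using hp(1) p0 by (metis dvd_mult_imp_div)
  have l: "l dvd M div p" if "prime l" "l dvd M" for l
    using hM[OF that] hMp by (rule dvd_trans)
  have p2: "p\<^sup>2 dvd M"
  proof -
    have "p * p dvd M div p * p" using l[OF p(1) pM] by (intro mult_dvd_mono) auto
    then show ?thesis using pM by (simp add: power2_eq_square)
  qed
  define th where "th = w ^ (M div p * (M div N))"
  have th: "prim_root p th"
  proof -
    have "prim_root p (w ^ (M div p))" using w pM by (intro prim_root_power_dvd) simp
    moreover have "coprime (M div N) p" using p(2) coprime_commute by blast
    ultimately show ?thesis unfolding th_def power_mult by (rule prim_root_power_coprime)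
  qed
  define Yt where "Yt j = (\<Sum>v<N. b v * (w ^ (M div N)) ^ v * th ^ (j * v))" for j
  obtain A where A: "ipoly A (w ^ (1 + j * (M div p))) = Yt j" for j
    unfolding Yt_def th_def using twisted_sum_conjugates[OF w hp p0 N, of b] b by blast
  have Y0: "Yt 0 = Y" by (simp add: Yt_def Y(1))
  have A0: "ipoly A w = Y" using A[of 0] by (simp add: Y0)
  have cop: "coprime (1 + j * (M div p)) M" for j by (rule coprime_one_plus_cofactor[OF l])
  have Yne: "Y \<noteq> 0" using Y(2) n(1) by auto
  \<comment> \<open>The relation for \<open>Yt 1\<close> is conjugated by the \<open>j\<close>th
    power of the automorphism, which also multiplies \<open>w ^ k\<close> by
    \<open>(w ^ (k * (M div p))) ^ j\<close>.\<close>
  have step: "Yt (Suc j) = of_int s * w ^ k * (w ^ (k * (M div p))) ^ j * Yt j"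
    if "Yt 1 = of_int s * w ^ k * Y" for s k j
  proof -
    define Q where "Q = pcompose A (monom 1 (1 + M div p)) - smult s (monom 1 k * A)"
    have "ipoly Q w = 0" using that A[of 1] A0 by (simp add: Q_def)
    then have "ipoly Q (w ^ (1 + j * (M div p))) = 0" by (rule ipoly_conjugate[OF w cop])
    then have "ipoly A ((w ^ (1 + j * (M div p))) ^ (1 + M div p))
        = of_int s * ((w ^ (1 + j * (M div p))) ^ k * Yt j)"
      by (simp only: Q_def ipoly_diff ipoly_pcompose_monom ipoly_smult ipoly_mult ipoly_monom of_int_1
          mult_1_left A right_minus_eq)
    moreover have "(w ^ (1 + j * (M div p))) ^ (1 + M div p) = w ^ (1 + Suc j * (M div p))"
      using one_plus_cofactor_cong[OF p2, of j 1]
      by (simp add: power_mult[symmetric] prim_root_power_eq_iff[OF w] del: power_Suc)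
    moreover have "(w ^ (1 + j * (M div p))) ^ k = w ^ k * (w ^ (k * (M div p))) ^ j"
      by (simp add: power_mult[symmetric] power_add[symmetric] algebra_simps)
    ultimately show ?thesis using A[of "Suc j"] by (simp only: mult.assoc)
  qed
  have Yt: "Yt j = (of_int s * w ^ k) ^ j * (w ^ (k * (M div p))) ^ (\<Sum>i<j. i) * Y"
    if "Yt 1 = of_int s * w ^ k * Y" for s k j
  proof (induction j)
    case (Suc j)
    then show ?case using step[OF that, of j] by (simp add: power_add mult_ac)
  qed (simp add: Y0)
  have thp: "th ^ p = 1" by (rule prim_rootD(2)[OF th])
  have Ytp: "Yt p = Y"
    by (simp add: Yt_def power_mult thp Y(1))
  note case1 = that(1) and case2 = that(2)
  have conclude: thesis if e1: "eps ^ p = 1" and e2: "Yt 1 = eps * Y" for eps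
  proof -
    obtain y where y: "eps = th ^ y" "y < p" using root_of_unity_eq_power[OF th e1] by blast
    define k where "k = M div p * (M div N) * y"
    have "M dvd k * (M div p)"
    proof -
      obtain r where r: "M = p * p * r" using p2 by (auto simp: power2_eq_square)
      have "M div p = p * r" using p0 by (simp add: r)
      then have "k * (M div p) = M * (r * (M div N) * y)" by (simp add: k_def r)
      then show ?thesis by simp
    qed
    then have "w ^ (k * (M div p)) = 1" by (simp add: M(3))
    moreover have "eps = w ^ k" by (simp add: y(1) k_def th_def power_mult)
    ultimately have Yj: "Yt j = th ^ (y * j) * Y" for j
      using Yt[of 1 k j] e2 y(1) by (simp add: power_mult)
    \<comment> \<open>Projection onto the eigenspace of \<open>th ^ y\<close>: by orthogonality of
      the powers of \<open>th\<close> only the terms with \<open>v mod p = y\<close>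
      survive.\<close>
    have "of_nat p * Y = (\<Sum>j<p. th ^ (j * (p - y)) * Yt j)"
    proof -
      have "th ^ (j * (p - y)) * th ^ (y * j) = 1" for j
      proof -
        have "j * (p - y) + y * j = p * j" using y(2) by (simp add: algebra_simps diff_mult_distrib2)
        then have "th ^ (j * (p - y)) * th ^ (y * j) = th ^ (p * j)" by (simp only: power_add[symmetric])
        then show ?thesis by (simp add: power_mult thp)
      qed
      then show ?thesis by (simp add: Yj mult.assoc[symmetric])
    qed
    also have "\<dots> = (\<Sum>v<N. b v * (w ^ (M div N)) ^ v * (\<Sum>j<p. th ^ (j * (v + (p - y)))))"
      unfolding Yt_def sum_distrib_left
      by (subst sum.swap) (simp add: algebra_simps power_add)
    also have "\<dots> = (\<Sum>v<N. if v mod p = y then of_nat p * (b v * (w ^ (M div N)) ^ v) else 0)"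
    proof (intro sum.cong refl)
      fix v
      have "p dvd v + (p - y) \<longleftrightarrow> v mod p = y"
      proof -
        have "p dvd v + (p - y) \<longleftrightarrow> [v + (p - y) + y = 0 + y] (mod p)"
          by (simp only: cong_add_rcancel_nat cong_0_iff)
        also have "v + (p - y) + y = v + p" using y(2) by simp
        also have "[v + p = 0 + y] (mod p) \<longleftrightarrow> v mod p = y" using y(2) by (simp add: cong_def)
        finally show ?thesis .
      qed
      then show "b v * (w ^ (M div N)) ^ v * (\<Sum>j<p. th ^ (j * (v + (p - y))))
          = (if v mod p = y then of_nat p * (b v * (w ^ (M div N)) ^ v) else 0)"
        by (simp add: prim_root_sum_powers[OF th])
    qed
    also have "\<dots> = of_nat p * (\<Sum>v | v < N \<and> v mod p = y. b v * (w ^ (M div N)) ^ v)"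
      by (simp add: sum.If_cases sum_distrib_left Int_def)
    finally have "Y = (\<Sum>v | v < N \<and> v mod p = y. b v * (w ^ (M div N)) ^ v)" using p0 by simp
    then show ?thesis using y(2) case1 by blast
  qed
  have "\<exists>s k. (s = 1 \<or> odd M \<and> s = -1) \<and> Yt 1 = of_int s * w ^ k * Y"
  proof -
    have tq': "\<And>q. prime q \<Longrightarrow> q dvd n \<Longrightarrow>
        \<exists>f. [1 + 1 * (M div p) = q ^ f] (mod M div q ^ multiplicity q M)"
      using tq by simp
    have YA: "ipoly A w * cnj (ipoly A w) = of_nat n" by (simp add: A0 Y(2))
    consider (1) k where "ipoly A (w ^ (1 + 1 * (M div p))) = w ^ k * ipoly A w"
      | (2) k where "odd M" "ipoly A (w ^ (1 + 1 * (M div p))) = - (w ^ k) * ipoly A w"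
      by (rule conjugate_eq_root_of_unity_times[OF w cop[of 1] n tq' YA])
    then show ?thesis
    proof cases
      case (1 k)
      then have "Yt 1 = of_int 1 * w ^ k * Y" unfolding A A0 by simp
      then show ?thesis by blast
    next
      case (2 k)
      then have "Yt 1 = of_int (-1) * w ^ k * Y" unfolding A A0 by simp
      then show ?thesis using 2(1) by blast
    qed
  qed
  then obtain s k where sk: "s = 1 \<or> odd M \<and> s = -1" "Yt 1 = of_int s * w ^ k * Y" by blast
  define eps where "eps = of_int s * w ^ k"
  define rho where "rho = w ^ (k * (M div p))"
  have rhop: "rho ^ p = 1"
  proof -
    have "rho ^ p = w ^ (k * (M div p) * p)" unfolding rho_def by (rule power_mult[symmetric])
    also have "k * (M div p) * p = M * k" using pM by simp
    finally show ?thesis by (simp add: power_mult M(2))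
  qed
  have Y1: "Yt 1 = eps * Y" using sk(2) by (simp add: eps_def)
  \<comment> \<open>After \<open>p\<close> applications the automorphism returns to
    \<open>Y\<close>. For odd \<open>p\<close> the exponent p(p-1)/2 of \<open>rho\<close> is a
    multiple of \<open>p\<close>, so \<open>rho\<close> drops out.\<close>
  have main: "eps ^ p * rho ^ (\<Sum>i<p. i) = 1"
    using Yt[OF sk(2), of p] Ytp Yne by (simp add: eps_def rho_def)
  show ?thesis
  proof (cases "p = 2")
    case False
    then have "odd p" using prime_ge_2_nat[OF p(1)] prime_odd_nat[OF p(1)] by simp
    then obtain r where r: "p = 2 * r + 1" by (elim oddE)
    have "(\<Sum>i<Suc j. i) * 2 = Suc j * j" for j :: nat by (induction j) auto
    from this[of "2 * r"] have "(\<Sum>i<p. i) = p * r" by (simp add: r)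
    then have "rho ^ (\<Sum>i<p. i) = 1" by (simp add: power_mult rhop)
    then have "eps ^ p = 1" using main by simp
    then show ?thesis using conclude Y1 by blast
  next
    case True
    have "even M" using pM True by simp
    then have s: "s = 1" using sk(1) by simp
    have sum2: "(\<Sum>i<2. i) = (1 :: nat)" by (simp add: numeral_2_eq_2)
    have m2: "eps\<^sup>2 * rho = 1" using main by (simp add: True sum2)
    show ?thesis
    proof (cases "rho = 1")
      case True
      then show ?thesis using conclude Y1 m2 \<open>p = 2\<close> by simp
    next
      case False
      then have rho: "rho = -1" using rhop by (simp add: True power2_eq_1_iff)
      have "- (eps\<^sup>2) = 1" using m2 by (simp only: rho mult_minus1_right)
      from arg_cong[OF this, of uminus] have eps2: "eps\<^sup>2 = -1" by simp
      have "\<not> 8 dvd M"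
      proof
        assume "8 dvd M"
        then obtain r where r: "M = 8 * r" by (elim dvdE)
        \<comment> \<open>\<open>eps\<close> has fourth power 1, and M/2 is a multiple of 4 when 8
          divides \<open>M\<close>.\<close>
        have "rho = eps ^ (M div 2)" by (simp add: rho_def eps_def s True power_mult)
        also have "M div 2 = 2 * (2 * r)" by (simp add: r)
        also have "eps ^ (2 * (2 * r)) = 1" by (simp only: power_mult eps2) simp
        finally show False using rho by simp
      qed
      moreover have "th = -1"
        using thp prim_rootD(3)[OF th, of 1] by (simp add: True power2_eq_1_iff)
      then have "(\<Sum>v<N. b v * (w ^ (M div N)) ^ v * (-1) ^ v) = eps * Y"
        using Y1 by (simp add: Yt_def)
      ultimately show ?thesis using eps2 True case2 by blast
    qed
  qed
qed

section \<open>Tools for the exceptional case p = 2\<close>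

text \<open>The automorphism with exponent 1 + M/2 preserves the vanishing; it fixes the
  \<open>b v\<close> and multiplies the term of index \<open>v\<close> by \<open>(-1) ^ v\<close>,
  since \<open>M div N\<close> is odd.\<close>

lemma vanishing_sum_twist:
  fixes b :: "nat \<Rightarrow> complex"
  assumes w: "prim_root M w" and h: "h * 2 dvd M" "h > 0" and N: "N dvd M" "odd (M div N)"
    and hM: "\<And>l. prime l \<Longrightarrow> l dvd M \<Longrightarrow> l dvd h"
    and b: "\<And>v. b v ^ h = 1" and 0: "(\<Sum>v<N. b v * (w ^ (M div N)) ^ v) = 0"
  shows "(\<Sum>v<N. b v * (w ^ (M div N)) ^ v * (-1) ^ v) = 0"
proof -
  have "2 dvd M" using h(1) by (rule dvd_mult_right)
  define th where "th = w ^ (M div 2 * (M div N))"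
  have "w ^ (M div 2) = -1"
  proof -
    have p2: "prim_root 2 (w ^ (M div 2))" using w \<open>2 dvd M\<close> by (intro prim_root_power_dvd) simp
    show ?thesis using prim_rootD(2)[OF p2] prim_rootD(3)[OF p2, of 1] by (simp add: power2_eq_1_iff)
  qed
  then have th: "th = -1" using N(2) by (simp add: th_def power_mult)
  obtain A where A: "ipoly A (w ^ (1 + j * (M div 2)))
      = (\<Sum>v<N. b v * (w ^ (M div N)) ^ v * th ^ (j * v))" for j
    unfolding th_def using twisted_sum_conjugates[OF w h(1,2) _ N(1), of b] b by auto
  have "h dvd M div 2" using h(1) by (metis dvd_mult_imp_div)
  then have "coprime (1 + 1 * (M div 2)) M"
    by (intro coprime_one_plus_cofactor) (use hM dvd_trans in blast)
  moreover have "ipoly A w = 0" using A[of 0] 0 by simp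
  ultimately have "ipoly A (w ^ (1 + 1 * (M div 2))) = 0" using ipoly_conjugate[OF w] by blast
  then show ?thesis unfolding A by (simp add: th)
qed

text \<open>Adding and subtracting the two equations gives 2A = (1 + eps) Y and 2IB = (1 - eps) Y,
  where A = b0 - b2 and B = b1 - b3. So A and B both have squared norm n/2, which is at most 4, with
  equality only for antipodal pairs.\<close>

lemma four_term_extremal:
  fixes b0 b1 b2 b3 I eps :: complex
  assumes norm: "norm b0 = 1" "norm b1 = 1" "norm b2 = 1" "norm b3 = 1"
    and I: "I\<^sup>2 = -1" and eps: "eps\<^sup>2 = -1"
    and Y: "Y = (b0 - b2) + I * (b1 - b3)" "(b0 - b2) - I * (b1 - b3) = eps * Y"
    and n: "Y * cnj Y = of_nat n"
  shows "n \<le> 8" and "n = 8 \<Longrightarrow> b2 = - b0 \<and> b3 = - b1 \<and> (b1 = b0 \<or> b1 = - b0)"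
proof -
  define A where "A = b0 - b2"
  define B where "B = b1 - b3"
  have AB: "2 * A = (1 + eps) * Y" "2 * (I * B) = (1 - eps) * Y"
  proof -
    have "2 * A = (A + I * B) + (A - I * B)" "2 * (I * B) = (A + I * B) - (A - I * B)" by simp_all
    moreover have "A + I * B = Y" "A - I * B = eps * Y" using Y by (simp_all add: A_def B_def)
    ultimately show "2 * A = (1 + eps) * Y" "2 * (I * B) = (1 - eps) * Y"
      by (simp_all add: algebra_simps)
  qed
  have "eps\<^sup>2 = \<i>\<^sup>2" using eps by simp
  then have eps_cases: "eps = \<i> \<or> eps = - \<i>" by (simp only: power2_eq_iff)
  have "I\<^sup>2 = eps\<^sup>2" using I eps by simp
  then have I_cases: "I = eps \<or> I = - eps" by (simp only: power2_eq_iff)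
  have nI: "norm I = 1" using I_cases eps_cases by auto
  have "complex_of_real ((norm Y)\<^sup>2) = of_real (real n)" 
    unfolding complex_norm_square using n by simp
  then have nY: "(norm Y)\<^sup>2 = real n" by (simp only: of_real_eq_iff)
  have ne: "(norm (1 + eps))\<^sup>2 = 2" "(norm (1 - eps))\<^sup>2 = 2"
    using eps_cases by (auto simp: cmod_power2)
  have "(norm (2 * A))\<^sup>2 = 2 * real n" "(norm (2 * (I * B)))\<^sup>2 = 2 * real n"
    unfolding AB by (simp_all add: norm_mult power_mult_distrib ne nY)
  then have nAB: "2 * (norm A)\<^sup>2 = real n" "2 * (norm B)\<^sup>2 = real n"
    by (simp_all add: norm_mult power_mult_distrib nI)
  have par: "(norm (u - v))\<^sup>2 + (norm (u + v))\<^sup>2 = 4" if "norm u = 1" "norm v = 1" for u v :: complex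
  proof -
    have "(norm (u - v))\<^sup>2 + (norm (u + v))\<^sup>2 = 2 * (norm u)\<^sup>2 + 2 * (norm v)\<^sup>2"
      unfolding cmod_power2 by (simp add: power2_eq_square algebra_simps)
    then show ?thesis using that by simp
  qed
  have "(norm A)\<^sup>2 \<le> 4" using par[OF norm(1,3)] unfolding A_def
    by (smt (verit) zero_le_power2)
  then show "n \<le> 8" using nAB(1) by linarith
  assume "n = 8"
  then have "(norm A)\<^sup>2 = 4" "(norm B)\<^sup>2 = 4" using nAB by auto
  then have "norm (b0 + b2) = 0" "norm (b1 + b3) = 0"
    using par[OF norm(1,3)] par[OF norm(2,4)] by (auto simp: A_def B_def)
  then have b: "b2 = - b0" "b3 = - b1" by (auto simp: add_eq_0_iff)
  then have AB': "A = 2 * b0" "B = 2 * b1" by (auto simp: A_def B_def)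
  \<comment> \<open>Eliminating \<open>Y\<close> relates \<open>b0\<close> to \<open>b1\<close>.
    Multiplying by \<open>1 - eps\<close>, with (1 - eps)^2 = -2 eps and (1 - eps)(1 + eps) = 2,
    makes the relation - eps b0 = I b1.\<close>
  have "(1 - eps) * (2 * A) = (1 + eps) * (2 * (I * B))" unfolding AB by (simp add: mult_ac)
  then have "(1 - eps) * b0 = (1 + eps) * (I * b1)" unfolding AB' by simp
  then have "(1 - eps) * ((1 - eps) * b0) = (1 - eps) * ((1 + eps) * (I * b1))" by simp
  moreover have "(1 - eps) * ((1 - eps) * b0) = - (2 * (eps * b0))"
    using eps by (simp add: algebra_simps power2_eq_square)
  moreover have "(1 - eps) * ((1 + eps) * (I * b1)) = 2 * (I * b1)"
    using eps by (simp add: algebra_simps power2_eq_square)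
  ultimately have "- (2 * (eps * b0)) = 2 * (I * b1)" by metis
  then have "2 * (- (eps * b0)) = 2 * (I * b1)" by (simp only: mult_minus_right)
  then have "- (eps * b0) = I * b1" by (simp only: mult_cancel_left) simp
  moreover have "eps \<noteq> 0" using eps by auto
  ultimately have "b1 = b0 \<or> b1 = - b0"
    using I_cases mult_cancel_left[of eps "- b0" b1] mult_cancel_left[of eps b0 b1] by auto
  then show "b2 = - b0 \<and> b3 = - b1 \<and> (b1 = b0 \<or> b1 = - b0)" using b by simp
qed

lemma sum_shift_mod:
  fixes g :: "nat \<Rightarrow> 'a::comm_monoid_add"
  assumes "n > 0"
  shows "(\<Sum>u<n. g ((v + u) mod n)) = (\<Sum>u<n. g u)"
proof (rule sum.reindex_bij_witness[of _ "\<lambda>u. (u + (n - v mod n)) mod n" "\<lambda>u. (v + u) mod n"])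
  fix u assume u: "u \<in> {..<n}"
  have le: "v mod n \<le> n" using assms by (simp add: less_imp_le)
  have "((v + u) mod n + (n - v mod n)) mod n = (v + u + (n - v mod n)) mod n" by (simp add: mod_simps)
  also have "\<dots> = (v mod n + (u + (n - v mod n))) mod n" by (simp add: mod_simps add.assoc)
  also have "v mod n + (u + (n - v mod n)) = u + n" using le by simp
  finally show "((v + u) mod n + (n - v mod n)) mod n = u" using u by simp
  have "(v + (u + (n - v mod n)) mod n) mod n = (v mod n + (u + (n - v mod n))) mod n" by (simp add: mod_simps)
  also have "v mod n + (u + (n - v mod n)) = u + n" using le by simp
  finally show "(v + (u + (n - v mod n)) mod n) mod n = u" using u by simp
qed (use assms in auto)

lemma sum_residue_class:
  fixes F :: "nat \<Rightarrow> 'a::comm_monoid_add"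
  assumes "p dvd N" "y < p"
  shows "(\<Sum>v | v < N \<and> v mod p = y. F v) = (\<Sum>v<N div p. F (y + p * v))"
proof (rule sum.reindex_bij_witness[of _ "\<lambda>v. y + p * v" "\<lambda>v. v div p"])
  obtain r where r: "N = p * r" using assms(1) by (elim dvdE)
  have p: "p > 0" using assms(2) by simp
  fix v assume "v \<in> {..<N div p}"
  then have v: "v < r" using p by (simp add: r)
  show "(y + p * v) div p = v" using assms(2) by simp
  have "y + p * v < p + p * v" using assms(2) by simp
  also have "\<dots> = p * Suc v" by simp
  also have "\<dots> \<le> N" unfolding r using v by (intro mult_le_mono2) simp
  finally show "y + p * v \<in> {v. v < N \<and> v mod p = y}" using assms(2) by simp
next
  obtain r where r: "N = p * r" using assms(1) by (elim dvdE)
  have p: "p > 0" using assms(2) by simp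
  fix v assume v: "v \<in> {v. v < N \<and> v mod p = y}"
  then show "y + p * (v div p) = v" by auto
  then show "F (y + p * (v div p)) = F v" by simp
  show "v div p \<in> {..<N div p}" using v p by (simp add: r less_mult_imp_div_less mult.commute)
qed

section \<open>Frobenius powers from condition (ii)\<close>

text \<open>For \<open>q = p\<close> the number M/p is a multiple of the modulus and f = 0 works.
  Otherwise a = q^d, with d the order of \<open>q\<close> modulo \<open>mtilde m q\<close>, is 1
  modulo every prime divisor of the modulus, and modulo 4 if \<open>p = 2\<close>, but by (ii) not
  modulo p^(v+1). The factor \<open>q ^ c\<close> turns N/p into M/p.\<close>

lemma exists_frobenius_power:
  assumes p: "prime p" and q: "prime q" and M: "M dvd m" "m > 0" "h * p dvd M" "h > 0" and "q dvd M"
    and nc: "q \<noteq> p \<Longrightarrow> \<not> [q ^ ord (mtilde m q) q = 1] (mod p ^ (multiplicity p h + 1))"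
  shows "\<exists>f. [1 + M div p = q ^ f] (mod M div q ^ multiplicity q M)"
proof -
  define c where "c = multiplicity q M"
  define N where "N = M div q ^ c"
  have MN: "M = q ^ c * N" by (simp add: N_def c_def multiplicity_dvd)
  have M0: "M > 0" using M by (meson dvd_pos_nat)
  have N0: "N > 0" using M0 MN by (metis gr0I mult_0_right)
  have c0: "c > 0" unfolding c_def using q \<open>q dvd M\<close> M0 by (simp add: prime_multiplicity_gt_zero_iff)
  have p0: "p > 0" using p by (rule prime_gt_0_nat)
  show ?thesis
  proof (cases "q = p")
    case True
    obtain c' where "c = Suc c'" using c0 gr0_conv_Suc by blast
    then have "M div p = N * p ^ c'" using MN True p0 by simp
    then have "[1 + M div p = q ^ 0] (mod N)" by (simp only: cong_def power_0 mod_mult_self2)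
    then show ?thesis unfolding N_def c_def by blast
  next
    case False
    have qN: "\<not> q dvd N"
      unfolding N_def c_def using q M0 multiplicity_decompose[of M q] not_prime_unit by blast
    then have copN: "coprime q N" using q by (simp add: prime_imp_coprime)
    define d where "d = ord (mtilde m q) q"
    define v where "v = multiplicity p h"
    have d: "[q ^ d = 1] (mod mtilde m q)" unfolding d_def by (rule ord)
    have pv: "p ^ Suc v dvd N"
    proof -
      have "p ^ v * p dvd h * p" unfolding v_def by (intro mult_dvd_mono multiplicity_dvd dvd_refl)
      then have "p ^ Suc v dvd q ^ c * N" using M(3) MN by (metis dvd_trans power_Suc2)
      moreover have "coprime (p ^ Suc v) (q ^ c)" using p q False primes_coprime
        by (metis coprime_power_left_iff coprime_power_right_iff)
      ultimately show ?thesis by (simp add: coprime_dvd_mult_right_iff)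
    qed
    have "\<exists>f. [(q ^ d) ^ f = 1 + (N div p) * q ^ c] (mod N)"
    proof (rule exists_power_cong_one_plus[OF p N0 pv])
      show "coprime (q ^ d) N" using copN by simp
      show "\<not> [q ^ d = 1] (mod p ^ Suc v)" using nc[OF False] by (simp add: d_def v_def)
    next
      fix l assume l: "prime l" "l dvd N"
      then have lm: "l dvd m" "l \<noteq> q" using qN MN M(1) by (auto intro: dvd_trans)
      have "l dvd mtilde m q"
      proof (cases "odd m \<or> q = 2")
        case True
        have "l dvd \<Prod>(prime_factors m - {q})"
          using l lm M(2) by (intro dvd_prodI[where f = "\<lambda>x. x", simplified]) (auto simp: prime_factors_dvd)
        then show ?thesis using True by (simp add: mtilde_def)
      next
        case False
        show ?thesis
        proof (cases "l = 2")
          case True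
          then show ?thesis using False by (simp add: mtilde_def)
        next
          case l2: False
          have "l dvd \<Prod>(prime_factors m - {2, q})"
            using l lm l2 M(2) by (intro dvd_prodI[where f = "\<lambda>x. x", simplified]) (auto simp: prime_factors_dvd)
          then show ?thesis using False by (simp add: mtilde_def)
        qed
      qed
      then show "[q ^ d = 1] (mod l)" using d cong_dvd_modulus_nat by blast
    next
      assume "p = 2"
      then have "even m" "q \<noteq> 2" using M(1,3) False by (auto intro: dvd_trans dvd_mult_right)
      then have "4 dvd mtilde m q" by (simp add: mtilde_def)
      then show "[q ^ d = 1] (mod 4)" using d cong_dvd_modulus_nat by blast
    qed
    then obtain f where f: "[(q ^ d) ^ f = 1 + (N div p) * q ^ c] (mod N)" by blast
    have "p dvd N" using dvd_trans[OF _ pv, of p] by simp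
    then have "(N div p) * q ^ c = M div p" by (simp add: MN div_mult_swap mult.commute)
    then have "[1 + M div p = q ^ (d * f)] (mod N)" using f by (simp add: power_mult cong_sym)
    then show ?thesis unfolding N_def c_def by blast
  qed
qed

section \<open>The exceptional case\<close>

lemma norm_eq_1_if_root_of_unity: "norm x = 1" if "x ^ h = 1" "h > 0" for x :: complex
proof -
  have "norm x ^ h = 1" using that(1) by (metis norm_one norm_power)
  then show ?thesis using power_eq_imp_eq_base[of "norm x" h 1] that(2) by simp
qed

text \<open>The order 8 survives the norm estimate in the exceptional case; it is excluded by the
  autocorrelation of the sequence at shift 2.\<close>

lemma no_sequence_of_period_eight:
  fixes c :: "nat \<Rightarrow> complex"
  assumes h: "even h" "\<not> 4 dvd h" "h > 0" and w: "prim_root M w" "h * 2 dvd M" "4 dvd M" "odd (M div 4)"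
    and hM: "\<And>l. prime l \<Longrightarrow> l dvd M \<Longrightarrow> l dvd h"
    and z: "z\<^sup>2 = w ^ (M div 4)" "z \<noteq> 0"
    and c: "\<And>u. c u ^ h = 1" "c 8 = c 0" "c 9 = c 1"
    and corr: "(\<Sum>u<8. c (u + 2) * cnj (c u)) = 0"
    and sum: "(\<Sum>u<8. c u * z ^ u) = (\<Sum>v<4. c (2 * v) * (z\<^sup>2) ^ v)"
    and ext: "c 4 = - c 0" "c 6 = - c 2" "c 2 = c 0 \<or> c 2 = - c 0"
  shows False
proof -
  define I where "I = w ^ (M div 4)"
  have pI: "prim_root 4 I" unfolding I_def using w(1,3) by (intro prim_root_power_dvd) simp
  have "(I\<^sup>2)\<^sup>2 = 1" using prim_rootD(2)[OF pI] by (simp flip: power_mult)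
  moreover have "I\<^sup>2 \<noteq> 1" using prim_rootD(3)[OF pI, of 2] by simp
  ultimately have I2: "I\<^sup>2 = -1" using power2_eq_1_iff[of "I\<^sup>2"] by blast
  have I3: "I ^ 3 = - I" using I2 by (simp add: power3_eq_cube power2_eq_square)
  have I0: "I \<noteq> 0" using I2 by auto
  define d where "d v = c (1 + 2 * v)" for v
  have four: "(\<Sum>v<4. F v) = F 0 + F 1 + F 2 + F 3" for F :: "nat \<Rightarrow> complex"
    by (simp add: eval_nat_numeral)
  have eight: "(\<Sum>v<8. F v) = F 0 + F 1 + F 2 + F 3 + F 4 + F 5 + F 6 + F 7" for F :: "nat \<Rightarrow> complex"
    by (simp add: eval_nat_numeral)
  \<comment> \<open>By \<open>sum\<close> the even indices carry the whole sum, so the odd part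
    vanishes. Together with its twist this gives \<open>c 5 = c 1\<close> and
    \<open>c 7 = c 3\<close>.\<close>
  have "(\<Sum>u<8. c u * z ^ u) = (\<Sum>v<4. c (2 * v) * (z\<^sup>2) ^ v) + z * (\<Sum>v<4. d v * (z\<^sup>2) ^ v)"
    unfolding four eight d_def by (simp add: power_mult[symmetric] algebra_simps eval_nat_numeral)
  then have d0: "(\<Sum>v<4. d v * I ^ v) = 0" using sum z by (simp add: I_def)
  then have "(\<Sum>v<4. d v * I ^ v * (-1) ^ v) = 0"
    unfolding I_def
    by (intro vanishing_sum_twist[OF w(1,2) h(3) w(3,4)]) (use hM c(1) in \<open>auto simp: d_def\<close>)
  then have e: "d 0 + d 1 * I - d 2 - d 3 * I = 0" "d 0 - d 1 * I - d 2 + d 3 * I = 0"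
    using d0 unfolding four by (simp_all add: I2 I3)
  have "2 * (d 0 - d 2) = (d 0 + d 1 * I - d 2 - d 3 * I) + (d 0 - d 1 * I - d 2 + d 3 * I)"
      "2 * (I * (d 1 - d 3)) = (d 0 + d 1 * I - d 2 - d 3 * I) - (d 0 - d 1 * I - d 2 + d 3 * I)"
    by (simp_all add: algebra_simps)
  then have "2 * (d 0 - d 2) = 0" "2 * (I * (d 1 - d 3)) = 0" unfolding e by simp_all
  then have "d 0 = d 2" "d 1 = d 3" using I0 by auto
  then have odd: "c 5 = c 1" "c 7 = c 3" by (simp_all add: d_def eval_nat_numeral)
  have real: "c 2 * cnj (c 0) = c 0 * cnj (c 2)" using ext(3) by auto
  define rho where "rho = c 3 * cnj (c 1)"
  \<comment> \<open>In the autocorrelation at shift 2 the even terms cancel, because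
    \<open>c 2 * cnj (c 0)\<close> is real; the odd terms contribute twice the sum of
    \<open>rho\<close> and its conjugate.\<close>
  have "rho + cnj rho = 0"
  proof -
    have "c 2 * cnj (c 0) + c 3 * cnj (c 1) + c 4 * cnj (c 2) + c 5 * cnj (c 3)
        + c 6 * cnj (c 4) + c 7 * cnj (c 5) + c 8 * cnj (c 6) + c 9 * cnj (c 7) = 0"
      using corr unfolding eight by (simp add: eval_nat_numeral)
    then have "2 * (rho + cnj rho) + 2 * (c 2 * cnj (c 0) - c 0 * cnj (c 2)) = 0"
      unfolding c(2,3) odd ext(1,2) rho_def by (simp add: algebra_simps)
    then have "2 * (rho + cnj rho) = 0" by (simp only: real diff_self mult_zero_right add_0_right)
    then show ?thesis by (simp only: mult_eq_0_iff) simp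
  qed
  then have cnj: "cnj rho = - rho" by (simp add: eq_neg_iff_add_eq_0 add.commute)
  have "norm rho = 1"
    using norm_eq_1_if_root_of_unity[OF c(1) h(3)] by (simp add: rho_def norm_mult)
  then have "rho * cnj rho = 1" by (simp flip: complex_norm_square)
  then have "rho\<^sup>2 = -1" by (simp add: cnj power2_eq_square equation_minus_iff)
  \<comment> \<open>\<open>rho\<close> is a square root of -1, so it is not an \<open>h\<close>th
    root of unity when \<open>h\<close> is twice an odd number.\<close>
  obtain h' where h': "h = 2 * h'" using h(1) by (elim evenE)
  then have "odd h'" using h(2) by auto
  then have "rho ^ h = -1" by (simp add: h' power_mult \<open>rho\<^sup>2 = -1\<close>)
  moreover have "rho ^ h = 1" using c(1)[of 1] c(1)[of 3]
    by (simp add: rho_def power_mult_distrib flip: complex_cnj_power)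
  ultimately show False by simp
qed

lemma dvd_two_power_eq_two:
  fixes y :: nat
  assumes "y dvd 2 ^ e" "2 dvd y" "\<not> 4 dvd y"
  shows "y = 2"
proof -
  obtain i where i: "y = 2 ^ i" using assms(1) divides_primepow_nat[of 2 y e] two_is_prime_nat by auto
  have "i < 2"
  proof (rule ccontr)
    assume "\<not> i < 2"
    then have "(2 :: nat) ^ 2 dvd 2 ^ i" by (intro le_imp_power_dvd) simp
    then show False using assms(3) by (simp add: i)
  qed
  moreover have "i \<noteq> 0" using assms(2) i by auto
  ultimately have "i = 1" by simp
  then show ?thesis by (simp add: i)
qed

lemma only_prime_two_imp_power:
  fixes n :: nat
  assumes "n > 0" "\<And>q. prime q \<Longrightarrow> q dvd n \<Longrightarrow> q = 2"
  obtains e where "n = 2 ^ e"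
proof -
  define e where "e = multiplicity 2 n"
  define N where "N = n div 2 ^ e"
  have N: "n = 2 ^ e * N" by (simp add: N_def e_def multiplicity_dvd)
  have "\<not> 2 dvd N" unfolding N_def e_def using multiplicity_decompose[of n 2] assms(1) by simp
  moreover have "q = 2" if "prime q" "q dvd N" for q using assms(2)[of q] that N by simp
  ultimately have "N = 1" using prime_factor_nat[of N] by blast
  then show ?thesis using that N by simp
qed

text \<open>As 8 does not divide \<open>M\<close>, \<open>h\<close> is twice an odd number.
  Condition (ii) for p = 2 thus has modulus 4, which divides \<open>mtilde m q\<close> for odd q, so
  \<open>n\<close> is a power of 2 and \<open>gcd h n = 2\<close>. Moreover
  \<open>n = 4 * k\<close>: \<open>Y\<close> has four terms and \<open>n \<le> 8\<close>. Excluding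
  8 leaves n = 4, where the bound is an equality.\<close>

lemma exceptional_descent:
  fixes c :: "nat \<Rightarrow> complex" and n h m k M x :: nat
  assumes nh: "n > 0" "h > 0" "m = lcm n h"
    and c: "\<And>u. c u ^ h = 1" "\<And>u. c (u mod n) = c u"
    and corr: "\<And>d. \<not> n dvd d \<Longrightarrow> (\<Sum>u<n. c (u + d) * cnj (c u)) = 0"
    and nc: "\<And>q. prime q \<Longrightarrow> q dvd n \<Longrightarrow> q \<noteq> 2 \<Longrightarrow>
        \<not> [q ^ ord (mtilde m q) q = 1] (mod 2 ^ (multiplicity 2 h + 1))"
    and k: "2 * k dvd n div gcd h n" "M = h * (n div gcd h n div k)" "\<not> 8 dvd M"
    and w: "prim_root M w" and hM: "\<And>l. prime l \<Longrightarrow> l dvd M \<Longrightarrow> l dvd h"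
    and z: "prim_root n z" "z ^ k = w ^ (M div (n div k))"
    and N: "n div k dvd M" "odd (M div (n div k))" and h2: "2 dvd h"
    and Y: "Y = (\<Sum>v<n div k. c (x + k * v) * (z ^ k) ^ v)" "Y * cnj Y = of_nat n"
    and X: "(\<Sum>u<n. c u * z ^ u) = z ^ x * Y"
    and eps: "eps\<^sup>2 = -1" "(\<Sum>v<n div k. c (x + k * v) * (z ^ k) ^ v * (-1) ^ v) = eps * Y"
  shows "n \<le> (gcd h n)\<^sup>2"
proof -
  define g where "g = gcd h n"
  define r where "r = n div g"
  have nr: "n = g * r" by (simp add: r_def g_def)
  have g0: "g > 0" using nh by (simp add: g_def)
  have r0: "r > 0" using nh nr by (cases r) auto
  obtain s where s: "r = 2 * k * s" using k(1) by (auto simp: r_def g_def elim: dvdE)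
  have k0: "k > 0" using s r0 by (cases k) auto
  have M_eq: "M = h * (2 * s)" using k(2) k0 s by (simp add: r_def[symmetric] g_def[symmetric])
  have h4: "\<not> 4 dvd h"
  proof
    assume "4 dvd h"
    then have "4 * 2 dvd h * (2 * s)" by (intro mult_dvd_mono) auto
    then show False using k(3) M_eq by simp
  qed
  have s2: "\<not> 2 dvd s"
  proof
    assume "2 dvd s"
    then have "2 * (2 * 2) dvd h * (2 * s)" using h2 by (intro mult_dvd_mono) auto
    then show False using k(3) M_eq by simp
  qed
  have "2 dvd n" using nr s by simp
  have mult2: "multiplicity 2 h = 1"
    using h2 h4 by (intro multiplicity_eqI) auto
  have "q = 2" if q: "prime q" "q dvd n" for q
  proof (rule ccontr)
    assume "q \<noteq> 2"
    have "even m" using nh(3) \<open>2 dvd n\<close> by auto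
    then have "4 dvd mtilde m q" using \<open>q \<noteq> 2\<close> by (simp add: mtilde_def)
    then have "[q ^ ord (mtilde m q) q = 1] (mod 4)" using ord cong_dvd_modulus_nat by blast
    then show False using nc[OF q \<open>q \<noteq> 2\<close>] by (simp add: mult2)
  qed
  then obtain e where e: "n = 2 ^ e" using only_prime_two_imp_power[OF nh(1)] by blast
  have g2: "g = 2"
  proof (rule dvd_two_power_eq_two[of _ e])
    show "g dvd 2 ^ e" unfolding e[symmetric] g_def by simp
    show "2 dvd g" using h2 \<open>2 dvd n\<close> by (simp add: g_def)
    show "\<not> 4 dvd g" using h4 by (auto simp: g_def)
  qed
  have "2 * s = 2"
  proof (rule dvd_two_power_eq_two[of _ e])
    have "n = (2 * s) * (g * k)" using nr s by simp
    then show "2 * s dvd 2 ^ e" unfolding e[symmetric] by simp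
    show "\<not> 4 dvd 2 * s" using s2 by (auto elim!: dvdE)
  qed simp
  then have n4: "n = 4 * k" using nr s g2 by simp
  have N4: "n div k = 4" using n4 k0 by simp
  define I where "I = z ^ k"
  have pI: "prim_root 4 I" unfolding I_def using z(1) n4 by (intro prim_root_power_dvd) simp
  have "(I\<^sup>2)\<^sup>2 = 1" using prim_rootD(2)[OF pI] by (simp flip: power_mult)
  moreover have "I\<^sup>2 \<noteq> 1" using prim_rootD(3)[OF pI, of 2] by simp
  ultimately have I2: "I\<^sup>2 = -1" using power2_eq_1_iff[of "I\<^sup>2"] by blast
  have I3: "I ^ 3 = - I" using I2 by (simp add: power3_eq_cube power2_eq_square)
  have four: "(\<Sum>v<4. F v) = F 0 + F 1 + F 2 + F 3" for F :: "nat \<Rightarrow> complex"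
    by (simp add: eval_nat_numeral)
  define b where "b v = c (x + k * v)" for v
  have nb: "norm (b v) = 1" for v unfolding b_def by (rule norm_eq_1_if_root_of_unity[OF c(1) nh(2)])
  have Y1: "Y = (b 0 - b 2) + I * (b 1 - b 3)"
    unfolding Y(1) N4 four by (simp add: b_def I_def[symmetric] I2 I3 algebra_simps)
  have Y2: "(b 0 - b 2) - I * (b 1 - b 3) = eps * Y"
    using eps(2) unfolding N4 four by (simp add: b_def I_def[symmetric] I2 I3 algebra_simps)
  note ext = four_term_extremal[OF nb nb nb nb I2 eps(1) Y1 Y2 Y(2)]
  have "k \<le> 2" using ext(1) n4 by simp
  have "k \<noteq> 2"
  proof
    assume k2: "k = 2"
    then have n8: "n = 8" using n4 by simp
    have ext': "b 2 = - b 0" "b 3 = - b 1" "b 1 = b 0 \<or> b 1 = - b 0" using ext(2)[OF n8] by auto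
    \<comment> \<open>Shifting by \<open>x\<close> moves the residue class carrying the sum to the
      even indices and leaves the cyclic autocorrelation unchanged.\<close>
    define c' where "c' u = c (x + u)" for u
    have per: "c ((x + u) mod 8) = c' u" for u using c(2)[of "x + u"] by (simp add: c'_def n8)
    have perz: "z ^ ((x + u) mod 8) = z ^ x * z ^ u" for u
      using prim_root_power_mod[OF z(1), of "x + u"] by (simp add: n8 power_add)
    have z0: "z \<noteq> 0" using prim_rootD(4)[OF z(1)] .
    show False
    proof (rule no_sequence_of_period_eight[where c = c' and z = z, OF h2 h4 nh(2) w])
      show "h * 2 dvd M" using M_eq by simp
      show "4 dvd M" "odd (M div 4)" using N by (simp_all add: N4)
      show "l dvd h" if "prime l" "l dvd M" for l using hM that .
      show "z\<^sup>2 = w ^ (M div 4)" using z(2) by (simp add: n8 k2)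
      show "z \<noteq> 0" by (rule z0)
      show "c' u ^ h = 1" for u by (simp add: c'_def c(1))
      show "c' 8 = c' 0" "c' 9 = c' 1"
      proof -
        have per8: "c (u + 8) = c u" for u using c(2)[of "u + 8"] c(2)[of u] by (simp add: n8)
        show "c' 8 = c' 0" by (simp add: c'_def per8)
        have "x + 9 = (x + 1) + 8" by simp
        then show "c' 9 = c' 1" by (simp only: c'_def per8)
      qed
      show "(\<Sum>u<8. c' (u + 2) * cnj (c' u)) = 0"
      proof -
        have "(\<Sum>u<8. c' (u + 2) * cnj (c' u)) = (\<Sum>u<8. c ((x + u) mod 8 + 2) * cnj (c ((x + u) mod 8)))"
        proof (intro sum.cong refl)
          fix u
          have "c ((x + u) mod 8 + 2) = c (((x + u) mod 8 + 2) mod 8)" using c(2) n8 by metis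
          also have "((x + u) mod 8 + 2) mod 8 = (x + (u + 2)) mod 8" by (simp add: mod_simps)
          finally have "c ((x + u) mod 8 + 2) = c' (u + 2)" by (simp only: per)
          then show "c' (u + 2) * cnj (c' u) = c ((x + u) mod 8 + 2) * cnj (c ((x + u) mod 8))"
            by (simp only: per)
        qed
        also have "\<dots> = (\<Sum>u<8. c (u + 2) * cnj (c u))"
          by (rule sum_shift_mod[where g = "\<lambda>u. c (u + 2) * cnj (c u)"]) simp
        also have "\<dots> = 0" using corr[of 2] by (simp add: n8)
        finally show ?thesis .
      qed
      show "(\<Sum>u<8. c' u * z ^ u) = (\<Sum>v<4. c' (2 * v) * (z\<^sup>2) ^ v)"
      proof -
        have "z ^ x * Y = (\<Sum>u<8. c ((x + u) mod 8) * z ^ ((x + u) mod 8))"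
          unfolding X[symmetric] n8
          by (rule sum_shift_mod[where g = "\<lambda>u. c u * z ^ u", symmetric]) simp
        also have "\<dots> = z ^ x * (\<Sum>u<8. c' u * z ^ u)"
          unfolding per perz sum_distrib_left by (intro sum.cong) auto
        finally have "Y = (\<Sum>u<8. c' u * z ^ u)" using z0 by simp
        then show ?thesis using Y(1) by (simp add: n8 k2 c'_def)
      qed
      show "c' 4 = - c' 0" "c' 6 = - c' 2" "c' 2 = c' 0 \<or> c' 2 = - c' 0"
        using ext' by (simp_all add: c'_def b_def k2)
    qed
  qed
  then have "k = 1" using \<open>k \<le> 2\<close> k0 by simp
  then show ?thesis unfolding g_def[symmetric] g2 using n4 by simp
qed

section \<open>Induction over the divisors of n / gcd(h,n)\<close>

lemma bh_sequence_bound: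
  fixes c :: "nat \<Rightarrow> complex" and n h m :: nat
  assumes nh: "n > 0" "h > 0" "m = lcm n h"
    and c: "\<And>u. c u ^ h = 1" "\<And>u. c (u mod n) = c u"
    and corr: "\<And>d. (\<Sum>u<n. c (u + d) * cnj (c u)) = (if n dvd d then of_nat n else 0)"
    and pdvd: "\<And>p. prime p \<Longrightarrow> p dvd n \<Longrightarrow> p dvd h"
    and nc: "\<And>p q. prime p \<Longrightarrow> p dvd n \<Longrightarrow> prime q \<Longrightarrow> q dvd n \<Longrightarrow> q \<noteq> p \<Longrightarrow>
        \<not> [q ^ ord (mtilde m q) q = 1] (mod p ^ (multiplicity p h + 1))"
  shows "n \<le> (gcd h n)\<^sup>2"
proof -
  define g where "g = gcd h n"
  define r where "r = n div g"
  have nr: "n = g * r" by (simp add: r_def g_def)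
  have g0: "g > 0" using nh by (simp add: g_def)
  have r0: "r > 0" using nh nr by (cases r) auto
  have m0: "m > 0" using nh by (simp add: lcm_pos_nat)
  have mh: "m = h * r"
  proof -
    have "g * m = h * n"
      unfolding g_def nh(3) using prod_gcd_lcm_nat[of h n] by (simp add: lcm.commute)
    also have "\<dots> = g * (h * r)" by (subst nr) simp
    finally show ?thesis using g0 by simp
  qed
  obtain h' where h': "h = g * h'" by (metis g_def gcd_dvd1 dvdE)
  have mn: "m = n * h'" using mh h' nr by simp
  have coph: "coprime h' r"
  proof -
    have "h' = h div g" using h' g0 by simp
    then show ?thesis using div_gcd_coprime[of h n] nh by (simp add: g_def r_def)
  qed
  define w0 where "w0 = cis (2 * pi / m)"
  have w0: "prim_root m w0" unfolding w0_def using m0 by (rule prim_root_cis)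
  define z where "z = w0 ^ h'"
  have z: "prim_root n z" unfolding z_def using w0 mn by (intro prim_root_power_dvd) simp
  note zD = prim_rootD[OF z]
  define X where "X = (\<Sum>u<n. c u * z ^ u)"
  have XX: "X * cnj X = of_nat n"
  proof -
    have shift: "c ((v + d) mod n) * z ^ ((v + d) mod n) * cnj (c v * z ^ v)
        = c (v + d) * cnj (c v) * z ^ d" for v d
    proof -
      have "z ^ v * cnj (z ^ v) = 1"
        unfolding complex_norm_square[symmetric] using zD(5) by (simp add: norm_power)
      moreover have "c ((v + d) mod n) * z ^ ((v + d) mod n) * cnj (c v * z ^ v)
          = c (v + d) * cnj (c v) * z ^ d * (z ^ v * cnj (z ^ v))"
        unfolding c(2) prim_root_power_mod[OF z] by (simp add: power_add mult_ac)
      ultimately show ?thesis by simp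
    qed
    \<comment> \<open>Substituting u = v + d modulo \<open>n\<close> makes this the Fourier
      transform of the autocorrelation, which is concentrated at d = 0.\<close>
    have "X * cnj X = (\<Sum>v<n. (\<Sum>u<n. c u * z ^ u) * cnj (c v * z ^ v))"
      unfolding X_def cnj_sum sum_distrib_left ..
    also have "\<dots> = (\<Sum>v<n. \<Sum>d<n. c (v + d) * cnj (c v) * z ^ d)"
    proof (intro sum.cong refl)
      fix v
      have "(\<Sum>u<n. c u * z ^ u) = (\<Sum>d<n. c ((v + d) mod n) * z ^ ((v + d) mod n))"
        by (rule sum_shift_mod[OF nh(1), where g = "\<lambda>u. c u * z ^ u", symmetric])
      then show "(\<Sum>u<n. c u * z ^ u) * cnj (c v * z ^ v) = (\<Sum>d<n. c (v + d) * cnj (c v) * z ^ d)"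
        by (simp only: sum_distrib_right shift)
    qed
    also have "\<dots> = (\<Sum>d<n. (\<Sum>v<n. c (v + d) * cnj (c v)) * z ^ d)"
      by (subst sum.swap) (simp add: sum_distrib_right)
    also have "\<dots> = (\<Sum>d<n. if d = 0 then of_nat n else 0)"
      by (intro sum.cong refl) (auto simp: corr dest: dvd_imp_le)
    also have "\<dots> = of_nat n" using nh(1) by (simp add: sum.delta)
    finally show ?thesis .
  qed
  \<comment> \<open>The terms on the right are those of \<open>X\<close> with index congruent to
    \<open>x\<close> modulo \<open>k\<close>; indices are read modulo \<open>n\<close>, the period
    of both \<open>c\<close> and the powers of \<open>z\<close>.\<close>
  define claim where "claim k \<longleftrightarrow>
      (\<exists>x. X = z ^ x * (\<Sum>v<n div k. c (x + k * v) * (z ^ k) ^ v))" for k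
  have main: "claim k \<or> n \<le> g\<^sup>2" if "k dvd r" for k
    using that
  proof (induction k rule: prime_divisors_induct)
    case zero
    then show ?case using r0 by simp
  next
    case (unit k)
    then have "k = 1" by simp
    moreover have "X = z ^ 0 * (\<Sum>v<n div 1. c (0 + 1 * v) * (z ^ 1) ^ v)" by (simp add: X_def)
    ultimately show ?case unfolding claim_def by blast
  next
    case (factor p k)
    have p: "prime p" by (rule factor(1))
    have "k dvd r" using factor.prems by (rule dvd_mult_right)
    show ?case
    proof (cases "n \<le> g\<^sup>2")
      case False
      then have "claim k" using factor.IH \<open>k dvd r\<close> by blast
      then obtain x where x: "X = z ^ x * (\<Sum>v<n div k. c (x + k * v) * (z ^ k) ^ v)"
        unfolding claim_def by blast
      define Y where "Y = (\<Sum>v<n div k. c (x + k * v) * (z ^ k) ^ v)"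
      have XY: "X = z ^ x * Y" using x by (simp add: Y_def)
      have "Y * cnj Y = X * cnj X"
      proof -
        have "z ^ x * cnj (z ^ x) = 1"
          unfolding complex_norm_square[symmetric] using zD(5) by (simp add: norm_power)
        moreover have "X * cnj X = (z ^ x * cnj (z ^ x)) * (Y * cnj Y)" by (simp add: XY mult_ac)
        ultimately show ?thesis by simp
      qed
      then have YY: "Y * cnj Y = of_nat n" using XX by simp
      obtain s where s: "r = p * k * s" using factor.prems by (elim dvdE)
      have k0: "k > 0" and s0: "s > 0" and p0: "p > 0" using s r0 by simp_all
      define M where "M = h * (p * s)"
      define N where "N = n div k"
      have Mk: "m = M * k" using mh s by (simp add: M_def)
      have N_eq: "N = g * p * s" using nr s k0 by (simp add: N_def)
      have MN: "M = N * h'" using h' N_eq by (simp add: M_def)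
      have N0: "N > 0" using N_eq g0 p0 s0 by simp
      have MdN: "M div N = h'" using MN N0 by simp
      define w where "w = w0 ^ k"
      have w: "prim_root M w" unfolding w_def using w0 Mk by (intro prim_root_power_dvd) simp
      have zk: "z ^ k = w ^ (M div N)" unfolding MdN by (simp add: z_def w_def power_mult[symmetric] mult.commute)
      have rn: "r dvd n" using nr by simp
      have pr: "p dvd r" using s by simp
      have pn: "p dvd n" using pr rn by (rule dvd_trans)
      have hM: "l dvd h" if "prime l" "l dvd M" for l
      proof -
        have "l dvd n * h'" using that(2) Mk mn by (metis dvd_mult2)
        then show ?thesis using that(1) pdvd h' by (auto simp: prime_dvd_mult_iff)
      qed
      have hpM: "h * p dvd M" by (simp add: M_def mult.assoc[symmetric])
      have nM: "q dvd M" if "prime q" "q dvd n" for q using pdvd[OF that] by (simp add: M_def)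
      \<comment> \<open>M/N = h/g is coprime to r = n/g, and \<open>p\<close> divides
        \<open>r\<close>.\<close>
      have copp: "coprime p (M div N)"
        unfolding MdN using coph pr by (meson coprime_commute coprime_divisors dvd_refl)
      have tq: "\<exists>f. [1 + M div p = q ^ f] (mod M div q ^ multiplicity q M)"
        if q: "prime q" "q dvd n" for q
        by (rule exists_frobenius_power[OF p q(1) _ m0 hpM nh(2) nM[OF q]])
          (use nc[OF p pn q] Mk in auto)
      consider (1) y where "y < p" "Y = (\<Sum>v | v < N \<and> v mod p = y. c (x + k * v) * (w ^ (M div N)) ^ v)"
        | (2) eps where "p = 2" "\<not> 8 dvd M" "eps\<^sup>2 = -1"
          "(\<Sum>v<N. c (x + k * v) * (w ^ (M div N)) ^ v * (-1) ^ v) = eps * Y"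
      proof (rule descent_step[OF w p copp hpM nh(2) _ hM _ nh(1) nM tq _ YY])
        show "N dvd M" using MN by simp
        show "c (x + k * v) ^ h = 1" for v by (rule c(1))
        show "Y = (\<Sum>v<N. c (x + k * v) * (w ^ (M div N)) ^ v)" by (simp add: Y_def zk N_def)
      qed
      then show ?thesis
      proof cases
        case (1 y)
        \<comment> \<open>The class of \<open>y\<close> modulo \<open>p\<close> among the
          \<open>v\<close> is the class of \<open>x + k * y\<close> modulo \<open>p * k\<close>
          among the indices of \<open>c\<close>.\<close>
        have "Y = (\<Sum>v<N div p. c (x + k * (y + p * v)) * (z ^ k) ^ (y + p * v))"
          unfolding 1(2) zk by (rule sum_residue_class[OF _ 1(1)]) (simp add: N_eq)
        also have "\<dots> = z ^ (k * y) * (\<Sum>v<N div p. c (x + k * y + p * k * v) * (z ^ (p * k)) ^ v)"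
          unfolding sum_distrib_left
          by (intro sum.cong refl) (simp add: power_add power_mult[symmetric] algebra_simps)
        finally have "X = z ^ (x + k * y) * (\<Sum>v<n div (p * k). c (x + k * y + p * k * v) * (z ^ (p * k)) ^ v)"
          unfolding XY by (simp add: N_def power_add div_mult2_eq mult.commute[of p k])
        then show ?thesis unfolding claim_def by blast
      next
        case (2 eps)
        have h2: "2 dvd h" using pdvd[OF p pn] 2(1) by simp
        have "n \<le> (gcd h n)\<^sup>2"
        proof (rule exceptional_descent[where c = c and M = M and w = w and z = z and k = k and x = x
              and Y = Y and eps = eps, OF nh])
          show "c u ^ h = 1" "c (u mod n) = c u" for u by (rule c)+
          show "(\<Sum>u<n. c (u + d) * cnj (c u)) = 0" if "\<not> n dvd d" for d using corr[of d] that by simp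
          show "\<not> [q ^ ord (mtilde m q) q = 1] (mod 2 ^ (multiplicity 2 h + 1))"
            if "prime q" "q dvd n" "q \<noteq> 2" for q
            using nc[of 2 q] that 2(1) pn by simp
          show "2 * k dvd n div gcd h n" using s 2(1) by (simp add: r_def[symmetric] g_def[symmetric])
          show "M = h * (n div gcd h n div k)"
            using s k0 by (simp add: r_def[symmetric] g_def[symmetric] M_def)
          show "odd (M div (n div k))" using copp 2(1) by (simp add: N_def)
          show "(\<Sum>v<n div k. c (x + k * v) * (z ^ k) ^ v * (-1) ^ v) = eps * Y"
            using 2(4) by (simp add: zk N_def)
        qed (use 2 w hM z zk h2 YY XY MN in \<open>auto simp: N_def Y_def X_def\<close>)
        then show ?thesis by (simp add: g_def)
      qed
    qed simp
  qed
  show ?thesis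
  proof (cases "n \<le> g\<^sup>2")
    case False
    then have "claim r" using main[of r] by simp
    then obtain x where x: "X = z ^ x * (\<Sum>v<n div r. c (x + r * v) * (z ^ r) ^ v)"
      unfolding claim_def by blast
    have "norm X = norm (\<Sum>v<n div r. c (x + r * v) * (z ^ r) ^ v)"
      unfolding x by (simp add: norm_mult norm_power zD(5))
    also have "\<dots> \<le> (\<Sum>v<n div r. norm (c (x + r * v) * (z ^ r) ^ v))" by (rule norm_sum)
    also have "\<dots> = real g"
      using nr r0 by (simp add: norm_mult norm_power zD(5) norm_eq_1_if_root_of_unity[OF c(1) nh(2)])
    finally have "(norm X)\<^sup>2 \<le> (real g)\<^sup>2" by (intro power_mono) auto
    moreover have "complex_of_real ((norm X)\<^sup>2) = of_real (real n)"
      unfolding complex_norm_square using XX by simp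
    then have "(norm X)\<^sup>2 = real n" by (simp only: of_real_eq_iff)
    ultimately have "real n \<le> real (g\<^sup>2)" by simp
    then show ?thesis by (simp only: of_nat_le_iff g_def)
  qed (simp add: g_def)
qed

section \<open>From the matrix to the sequence\<close>

text \<open>By invariance the entry in row \<open>a\<close> and column -u is
  \<open>c (a + u)\<close>, so orthogonality of rows \<open>a\<close> and 0 is the autocorrelation
  identity at shift \<open>a\<close>.\<close>

lemma bh_matrix_sequence:
  assumes n: "n > 0" and H: "BH_matrix (integer_mod_group n) h H"
  obtains c :: "nat \<Rightarrow> complex" where "\<And>u. c u ^ h = 1" "\<And>u. c (u mod n) = c u"
    "\<And>d. (\<Sum>u<n. c (u + d) * cnj (c u)) = (if n dvd d then of_nat n else 0)"
proof -
  have car: "carrier (integer_mod_group n) = {0..<int n}" using n by (simp add: carrier_integer_mod_group)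
  have ordn: "Coset.order (integer_mod_group n) = n" by (simp add: Coset.order_def car)
  have H1: "H a b ^ h = 1" if "a \<in> {0..<int n}" "b \<in> {0..<int n}" for a b
    using H that unfolding BH_matrix_def car by blast
  have H2: "H ((a + l) mod int n) ((b + l) mod int n) = H a b"
    if "a \<in> {0..<int n}" "b \<in> {0..<int n}" "l \<in> {0..<int n}" for a b l
    using H that unfolding BH_matrix_def car by simp
  have H3: "(\<Sum>l\<in>{0..<int n}. H a l * cnj (H b l)) = (if a = b then of_nat n else 0)"
    if "a \<in> {0..<int n}" "b \<in> {0..<int n}" for a b
    using H that unfolding BH_matrix_def car ordn by blast
  define c where "c u = H (int u mod int n) 0" for u
  have pos: "int n > 0" using n by simp
  have c_eq: "H a (- int u mod int n) = c (nat a + u)" if a: "a \<in> {0..<int n}" for a u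
  proof -
    have "H ((a + int u mod int n) mod int n) ((- int u mod int n + int u mod int n) mod int n)
        = H a (- int u mod int n)"
      using a pos by (intro H2) auto
    moreover have "(- int u mod int n + int u mod int n) mod int n = 0" by (simp add: mod_simps)
    moreover have "(a + int u mod int n) mod int n = int (nat a + u) mod int n"
      using a by (simp add: mod_simps)
    ultimately show ?thesis by (simp add: c_def)
  qed
  show ?thesis
  proof (rule that[of c])
    show "c u ^ h = 1" for u unfolding c_def using pos by (intro H1) auto
    show "c (u mod n) = c u" for u by (simp add: c_def zmod_int)
    fix d
    define a where "a = int d mod int n"
    have a: "a \<in> {0..<int n}" using pos by (simp add: a_def)
    have per: "c (nat a + u) = c (u + d)" for u
      using a by (simp add: c_def a_def mod_simps add.commute)
    have "(\<Sum>u<n. c (u + d) * cnj (c u)) = (\<Sum>u<n. H a (- int u mod int n) * cnj (H 0 (- int u mod int n)))"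
      using a pos by (intro sum.cong refl) (simp add: c_eq per)
    also have "\<dots> = (\<Sum>l\<in>{0..<int n}. H a l * cnj (H 0 l))"
    proof (rule sum.reindex_bij_witness[of _ "\<lambda>l. nat (- l mod int n)" "\<lambda>u. - int u mod int n"])
      fix u assume "u \<in> {..<n}"
      then show "nat (- (- int u mod int n) mod int n) = u" by (simp add: mod_minus_eq)
      show "- int u mod int n \<in> {0..<int n}" using pos by simp
    next
      fix l assume "l \<in> {0..<int n}"
      then show "- int (nat (- l mod int n)) mod int n = l" using pos by (simp add: mod_minus_eq)
      show "nat (- l mod int n) \<in> {..<n}" using pos by (simp add: nat_less_iff)
    qed simp
    also have "\<dots> = (if a = 0 then of_nat n else 0)" using a pos by (intro H3) auto
    also have "a = 0 \<longleftrightarrow> n dvd d"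
      unfolding a_def by (metis int_dvd_int_iff mod_0_imp_dvd dvd_imp_mod_0)
    finally show "(\<Sum>u<n. c (u + d) * cnj (c u)) = (if n dvd d then of_nat n else 0)" .
  qed
qed

theorem theorem3p2:
  fixes n h m :: nat
  assumes "n > 0" and "h > 0"
    and "m = lcm n h"
    and "\<exists>H. BH_matrix (integer_mod_group n) h H"
    and "\<And>p. prime p \<Longrightarrow> p dvd n \<Longrightarrow> p dvd h"
    and "\<And>p q. prime p \<Longrightarrow> p dvd n \<Longrightarrow> prime q \<Longrightarrow> q dvd n \<Longrightarrow> q \<noteq> p \<Longrightarrow>
           \<not> [q ^ ord (mtilde m q) q = 1] (mod p ^ (multiplicity p h + 1))"
  shows "n \<le> (gcd h n)\<^sup>2"
proof -
  obtain H where "BH_matrix (integer_mod_group n) h H" using assms(4) by blast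
  then obtain c :: "nat \<Rightarrow> complex" where "\<And>u. c u ^ h = 1" "\<And>u. c (u mod n) = c u"
    "\<And>d. (\<Sum>u<n. c (u + d) * cnj (c u)) = (if n dvd d then of_nat n else 0)"
    using bh_matrix_sequence[OF assms(1)] by blast
  from bh_sequence_bound[OF assms(1-3) this assms(5,6)] show ?thesis by simp
qed

end
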